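(* Let $\nu=(\nu_1>\cdots>\nu_{2m}>0)$ be a strict partition of even length $2m\le n$. Then $$GQ_\nu(x_1,\dots,x_n|\mathbf b)=\mathrm{Pf}\Big(\sum_{k=0}^\infty\sum_{l=0}^\infty\binom{i+1-2m}{k}\binom{j-2m}{l}\beta^{k+l}\,GQ^{(\nu_i,\nu_j)}_{(\nu_i+k,\nu_j+l)}(x_1,\dots,x_n|\mathbf b)\Big)_{1\le i<j\le 2m}.$$
   Context: Multiplicative formal group law: $x\oplus y:=x+y+\beta xy$, $\bar x:=-x/(1+\beta x)$, $x\ominus y:=x\oplus\bar y=(x-y)/(1+\beta y)$, $\beta$ a formal parameter. $x_1,\dots,x_n$ and $\mathbf b=(b_1,b_2,\dots)$ are indeterminates. $K$-theoretic factorial $Q$-functions: for strict $\nu$ of length $r\le n$, $GQ_\nu(x_1,\dots,x_n|\mathbf b):=\sum_{\bar w\in S_n/(S_1)^r\times S_{n-r}}w\cdot\Big[\prod_{i=1}^r(x_i\oplus x_i)\prod_{k=1}^{\nu_i-1}(x_i\oplus b_k)\prod_{i=1}^r\prod_{j=i+1}^n\frac{x_i\oplus x_j}{x_i\ominus x_j}\Big]$ ($S_n$ permutes only the $x$'s; sum over coset representatives). For an integer $q\ge0$ let $G^{(q)}(u):=\frac1{1+\beta u}\prod_{j=1}^n\frac{u\oplus x_j}{u\ominus x_j}\prod_{k=1}^{q}\frac{u\oplus b_k}{u}$. For integers $p,q\ge1$ and $k,l\ge1$ define $GQ^{(p,q)}_{(k,l)}(x_1,\dots,x_n|\mathbf b):=[u_1^{-k}u_2^{-l}]\Big(G^{(p-1)}(u_1)\,G^{(q-1)}(u_2)\,\frac{u_2\ominus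 u_1}{u_2\oplus u_1}\Big)$, where $[m](\cdot)$ denotes the coefficient of the monomial $m$, the expression is expanded in powers of the $x_j,b_k$ (denominators $u\ominus x_j$ in powers of $x_j$) and $1/(u_2\oplus u_1)$ is expanded in powers of $u_1$ with coefficients Laurent in $u_2$. $\binom{N}{k}:=N(N-1)\cdots(N-k+1)/k!$ for any integer $N$. $\mathrm{Pf}(a_{ij})_{1\le i<j\le2m}$ is the Pfaffian of the skew-symmetric $2m\times 2m$ matrix with upper entries $a_{ij}$. *)

theory Defs
  imports "HOL-Library.Poly_Mapping"
          "HOL-Computational_Algebra.Formal_Power_Series"
          "HOL-Computational_Algebra.Fraction_Field"
          "HOL-Combinatorics.Permutations"
begin

text \<open>Polynomials with integer coefficients in countably many variables (indexed by nat).
  Variable 0 is beta, variable 2j is x_j (j >= 1), variable 2k+1 is b_k (k >= 1).\<close>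

type_synonym mpoly = "(nat \<Rightarrow>\<^sub>0 nat) \<Rightarrow>\<^sub>0 int"

definition pvar :: "nat \<Rightarrow> mpoly" where
  "pvar i = Poly_Mapping.single (Poly_Mapping.single i 1) 1"

text \<open>A formal power series in the variables beta, x_j, b_k is represented through its
  homogeneous decomposition: the series sum_d f_d (f_d homogeneous of degree d) is the
  element sum_d f_d t^d of mpoly[[t]].  This is an injective ring homomorphism, and the
  (beta,x,b)-adic topology corresponds to the t-adic one.  Concretely a variable v is
  represented by v * t.\<close>

type_synonym ser = "mpoly fps"

definition var :: "nat \<Rightarrow> ser" where
  "var i = fps_const (pvar i) * fps_X"

definition beta :: ser where "beta = var 0"
definition xv :: "nat \<Rightarrow> ser" where "xv j = var (2 * j)"
definition bv :: "nat \<Rightarrow> ser" where "bv k = var (2 * k + 1)"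

text \<open>Sum of a family of series that converges in the adic topology (finitely many
  summands contribute to each degree); the value is junk otherwise.\<close>

definition tsum :: "('i \<Rightarrow> ser) \<Rightarrow> 'i set \<Rightarrow> ser" where
  "tsum f I = Abs_fps (\<lambda>d. \<Sum>i\<in>{i\<in>I. fps_nth (f i) d \<noteq> 0}. fps_nth (f i) d)"

definition fgl_plus :: "'a::comm_ring_1 \<Rightarrow> 'a \<Rightarrow> 'a \<Rightarrow> 'a" where
  "fgl_plus b x y = x + y + b * x * y"

definition fgl_minus :: "'a::field \<Rightarrow> 'a \<Rightarrow> 'a \<Rightarrow> 'a" where
  "fgl_minus b x y = (x - y) / (1 + b * y)"

type_synonym rat_fun = "ser fract"

definition emb :: "ser \<Rightarrow> rat_fun" where "emb f = Fract f 1"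

text \<open>GQ_nu(x_1..x_n | b) for a strict partition nu = (nu 1 > ... > nu r > 0),
  given as a 1-indexed function.  The sum over S_n/(S_1)^r x S_(n-r) is taken over the
  canonical coset representatives: permutations w of {1..n} increasing on {r+1..n}.
  The permutation w acts by x_i |-> x_(w i).\<close>

definition GQ :: "nat \<Rightarrow> nat \<Rightarrow> (nat \<Rightarrow> nat) \<Rightarrow> rat_fun" where
  "GQ n r nu =
    (let B = emb beta; X = (\<lambda>i. emb (xv i)); Bk = (\<lambda>k. emb (bv k)) in
     \<Sum>w\<in>{w. w permutes {1..n} \<and> (\<forall>i j. r < i \<longrightarrow> i < j \<longrightarrow> j \<le> n \<longrightarrow> w i < w j)}.
       (\<Prod>i=1..r. fgl_plus B (X (w i)) (X (w i)) * (\<Prod>k=1..nu i - 1. fgl_plus B (X (w i)) (Bk k)))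
     * (\<Prod>i=1..r. \<Prod>j=i+1..n. fgl_plus B (X (w i)) (X (w j)) / fgl_minus B (X (w i)) (X (w j))))"

text \<open>An element is given by its coefficient function: (a,b) |-> coefficient of u1^a u2^b.\<close>

type_synonym lser = "int \<times> int \<Rightarrow> ser"

definition lmono :: "ser \<Rightarrow> int \<Rightarrow> int \<Rightarrow> lser" where
  "lmono c a b = (\<lambda>(a', b'). if a' = a \<and> b' = b then c else 0)"

definition lconst :: "ser \<Rightarrow> lser" where "lconst c = lmono c 0 0"
definition lone :: lser where "lone = lconst 1"

definition ladd :: "lser \<Rightarrow> lser \<Rightarrow> lser" where
  "ladd f g = (\<lambda>ab. f ab + g ab)"

definition lneg :: "lser \<Rightarrow> lser" where
  "lneg f = (\<lambda>ab. - f ab)"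

definition lsub :: "lser \<Rightarrow> lser \<Rightarrow> lser" where
  "lsub f g = ladd f (lneg g)"

definition lmul :: "lser \<Rightarrow> lser \<Rightarrow> lser" where
  "lmul f g = (\<lambda>(a, b). tsum (\<lambda>(c, d). f (c, d) * g (a - c, b - d)) UNIV)"

fun lpow :: "lser \<Rightarrow> nat \<Rightarrow> lser" where
  "lpow f 0 = lone"
| "lpow f (Suc m) = lmul f (lpow f m)"

definition lsum :: "(nat \<Rightarrow> lser) \<Rightarrow> lser" where
  "lsum F = (\<lambda>ab. tsum (\<lambda>m. F m ab) UNIV)"

definition linv1 :: "lser \<Rightarrow> lser" where
  "linv1 e = lsum (\<lambda>m. lpow (lneg e) m)"

definition lprod :: "nat list \<Rightarrow> (nat \<Rightarrow> lser) \<Rightarrow> lser" where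
  "lprod is f = foldr (\<lambda>i acc. lmul (f i) acc) is lone"

definition u1 :: lser where "u1 = lmono 1 1 0"
definition u1inv :: lser where "u1inv = lmono 1 (-1) 0"
definition u2 :: lser where "u2 = lmono 1 0 1"
definition u2inv :: lser where "u2inv = lmono 1 0 (-1)"

definition lfgl_plus :: "lser \<Rightarrow> ser \<Rightarrow> lser" where
  "lfgl_plus u c = ladd (ladd u (lconst c)) (lmul (lconst (beta * c)) u)"

text \<open>G^(q)(u) = 1/(1+beta u) prod_j (u (+) x_j)/(u (-) x_j) prod_(k<=q) (u (+) b_k)/u,
  where 1/(u (-) x) = (1 + beta x)/(u - x) = (1+beta x) u^-1 sum_i (x/u)^i
  (expansion in powers of x), and 1/(1+beta u) = sum_i (-beta u)^i.\<close>

definition Gq :: "nat \<Rightarrow> nat \<Rightarrow> lser \<Rightarrow> lser \<Rightarrow> lser" where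
  "Gq n q u uinv =
     lmul (linv1 (lmul (lconst beta) u))
       (lmul (lprod [1..<n+1] (\<lambda>j. lmul (lfgl_plus u (xv j))
                (lmul (lconst (1 + beta * xv j)) (lmul uinv (linv1 (lneg (lmul (lconst (xv j)) uinv)))))))
             (lprod [1..<q+1] (\<lambda>k. lmul (lfgl_plus u (bv k)) uinv)))"

text \<open>(u2 (-) u1)/(u2 (+) u1) = (u2 - u1)/(1 + beta u1) * 1/(u2 + u1 + beta u1 u2),
  and 1/(u2 (+) u1) = u2^-1 / (1 + u1 u2^-1 + beta u1), expanded in powers of u1.\<close>

definition kernel :: lser where
  "kernel = lmul (lsub u2 u1)
     (lmul (linv1 (lmul (lconst beta) u1))
        (lmul u2inv (linv1 (ladd (lmul u1 u2inv) (lmul (lconst beta) u1)))))"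

definition GQpq :: "nat \<Rightarrow> nat \<Rightarrow> nat \<Rightarrow> nat \<Rightarrow> nat \<Rightarrow> ser" where
  "GQpq n p q k l =
     lmul (Gq n (p - 1) u1 u1inv) (lmul (Gq n (q - 1) u2 u2inv) kernel) (- int k, - int l)"

text \<open>binom N k = N(N-1)...(N-k+1)/k! (the division is exact).\<close>
definition zbinom :: "int \<Rightarrow> nat \<Rightarrow> int" where
  "zbinom N k = (\<Prod>i=0..<k. N - int i) div fact k"

text \<open>Pf of the skew-symmetric 2m x 2m matrix with upper entries M i j (i<j), as the sum over
  perfect matchings, encoded by permutations s with s(2i-1) < s(2i) and
  s(1) < s(3) < ... < s(2m-1).\<close>

definition pfaffian :: "nat \<Rightarrow> (nat \<Rightarrow> nat \<Rightarrow> 'a::comm_ring_1) \<Rightarrow> 'a" where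
  "pfaffian m M =
    (\<Sum>s\<in>{s. s permutes {1..2*m} \<and> (\<forall>i\<in>{1..m}. s (2*i - 1) < s (2*i))
                 \<and> (\<forall>i\<in>{1..<m}. s (2*i - 1) < s (2*i + 1))}.
       of_int (sign s) * (\<Prod>i\<in>{1..m}. M (s (2*i - 1)) (s (2*i))))"

end

(* Each series G^(q)(u) expands two-sidedly in u, and taking the coefficient of u^(-nu) is a sum of
   residues at u = x_1, ..., x_n.  At u_1 = x_a the denominator u_2 (+) u_1 of the kernel cancels
   against the factor u_2 (+) x_a of G(u_2), so the (i,j) entry of the matrix becomes
   sum_(a,b) P_(i,a) P_(j,b) K_(a,b) with K_(a,b) = (x_b - x_a) / (x_b (+) x_a); the binomial sums
   are the factors (1 + beta u)^(i+1-2m) and (1 + beta u)^(j-2m), which end up in P and make the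
   kernel skew-symmetric.  Expanding the Pfaffian multilinearly gives a sum over maps
   f : {1..2m} -> {1..n} of prod_i P_(i,f i) times the Pfaffian of (K_(f i, f j)), which is a product
   by Schur's identity.  It vanishes unless f is injective, and the injective f are the coset
   representatives in the definition of GQ. *)

theory Submission
  imports Defs "HOL-Computational_Algebra.Formal_Laurent_Series"
begin

subsection \<open>Double Laurent series\<close>

text \<open>The two variables of the kernel are not on the same footing. Expanded in powers of u_1,
  the factor 1/(u_2 (+) u_1) has no negative powers of u_1 but unboundedly many negative powers of
  u_2. Hence the residue in u_1 comes first, and only the cancellation at u_1 = x_a leaves a series
  whose poles in u_2 are again just the points x_b. The same asymmetry sits in u_2 (-) u_1 = (u_2 -
  u_1)/(1 + beta u_1): together with the 1/(1 + beta u) of each G it gives u_1 two such factors and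
  u_2 only one. The binomial tops i+1-2m and j-2m differ in form by exactly this one, so that
  position t always carries (1 + beta x)^-(2m+1-t), whether it stands first or second in its pair.
  The final comparison with GQ uses up precisely this power.\<close>

text \<open>The outer variable is the grading variable \<open>t\<close> of \<open>ser\<close>, the middle one \<open>u\<^sub>1\<close>, the inner one
  \<open>u\<^sub>2\<close>.  In each \<open>t\<close>-degree the series of the theorem are Laurent series in \<open>u\<^sub>1\<close> over Laurent
  series in \<open>u\<^sub>2\<close>, so the infinite convolutions \<open>lmul\<close> become products in this commutative ring.\<close>

type_synonym biser = "mpoly fls fls fps"

definition cf :: "biser \<Rightarrow> lser" where
  "cf F = (\<lambda>(a, b). Abs_fps (\<lambda>d. fls_nth (fls_nth (fps_nth F d) a) b))"

lemma cf_nth: "fps_nth (cf F (a, b)) d = fls_nth (fls_nth (fps_nth F d) a) b"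
  by (simp add: cf_def)

lemma tsum_nth:
  assumes "finite T" "\<And>i. fps_nth (f i) d \<noteq> 0 \<Longrightarrow> i \<in> T"
  shows "fps_nth (tsum f UNIV) d = (\<Sum>i\<in>T. fps_nth (f i) d)"
  unfolding tsum_def fps_nth_Abs_fps
  by (rule sum.mono_neutral_left) (use assms in auto)

lemma tsum_reindex:
  assumes "inj h" "\<And>i. i \<notin> range h \<Longrightarrow> f i = 0"
  shows "tsum f UNIV = tsum (f \<circ> h) UNIV"
proof (rule fps_ext)
  fix d
  have "bij_betw h {i. fps_nth (f (h i)) d \<noteq> 0} {i. fps_nth (f i) d \<noteq> 0}"
    unfolding bij_betw_def
  proof
    show "inj_on h {i. fps_nth (f (h i)) d \<noteq> 0}" using assms(1) by (auto simp: inj_on_def)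
    show "h ` {i. fps_nth (f (h i)) d \<noteq> 0} = {i. fps_nth (f i) d \<noteq> 0}"
      using assms(2) by (auto simp: image_iff) (metis fps_zero_nth rangeE)
  qed
  from sum.reindex_bij_betw[OF this, of "\<lambda>i. fps_nth (f i) d"]
  show "fps_nth (tsum f UNIV) d = fps_nth (tsum (f \<circ> h) UNIV) d"
    by (simp add: tsum_def)
qed

lemma tsum_single:
  assumes "\<And>i. i \<noteq> j \<Longrightarrow> f i = 0"
  shows "tsum f UNIV = f j"
proof (rule fps_ext)
  fix d
  have "fps_nth (tsum f UNIV) d = (\<Sum>i\<in>{j}. fps_nth (f i) d)"
    by (rule tsum_nth) (use assms in fastforce)+
  then show "fps_nth (tsum f UNIV) d = fps_nth (f j) d" by simp
qed

lemma tsum_zero: "tsum (\<lambda>_. 0) UNIV = 0"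
  by (simp add: tsum_def fps_eq_iff)

lemma fls_nth_sum: "fls_nth (sum f A) n = (\<Sum>x\<in>A. fls_nth (f x) n)"
  by (induction A rule: infinite_finite_induct) auto

text \<open>In a fixed degree d the convolution has finite support: the pole orders in u_1 bound c,
  and for each c the pole orders of the two coefficient series bound the exponent e of u_2.
  \<open>tsum\<close> collects pairs by their whole degree-d coefficient, so all splittings d = i +
  (d - i) have to share one finite set of pairs.\<close>

lemma cf_mult: "cf (F * G) = lmul (cf F) (cf G)"
proof (rule ext, rule prod.induct)
  fix a b :: int
  show "cf (F * G) (a, b) = lmul (cf F) (cf G) (a, b)"
  proof (rule fps_ext)
    fix d
    define I where "I i = {fls_subdegree (fps_nth F i)..a - fls_subdegree (fps_nth G (d - i))}" for i
    define J where "J i c = {fls_subdegree (fls_nth (fps_nth F i) c)..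
        b - fls_subdegree (fls_nth (fps_nth G (d - i)) (a - c))}" for i c
    define T where "T = (\<Union>i\<in>{0..d}. SIGMA c:I i. J i c)"
    define t where "t i = (\<lambda>(c, e). fls_nth (fls_nth (fps_nth F i) c) e *
        fls_nth (fls_nth (fps_nth G (d - i)) (a - c)) (b - e))" for i
    have fin: "finite T" unfolding T_def I_def J_def by auto
    have supp: "p \<in> (SIGMA c:I i. J i c)" if "t i p \<noteq> 0" for i p
    proof -
      obtain c e where p: "p = (c, e)" by force
      have 1: "fls_nth (fls_nth (fps_nth F i) c) e \<noteq> 0"
        and 2: "fls_nth (fls_nth (fps_nth G (d - i)) (a - c)) (b - e) \<noteq> 0"
        using that by (auto simp: p t_def)
      from 1 have 3: "fls_nth (fps_nth F i) c \<noteq> 0" by auto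
      from 2 have 4: "fls_nth (fps_nth G (d - i)) (a - c) \<noteq> 0" by auto
      from 1 2 3 4 show ?thesis
        using fls_subdegree_leI[OF 1] fls_subdegree_leI[OF 2] fls_subdegree_leI[OF 3] fls_subdegree_leI[OF 4]
        by (auto simp: p I_def J_def)
    qed
    have inner: "fls_nth (fls_nth (fps_nth F i * fps_nth G (d - i)) a) b = (\<Sum>p\<in>T. t i p)"
      if "i \<in> {0..d}" for i
    proof -
      have "fls_nth (fls_nth (fps_nth F i * fps_nth G (d - i)) a) b
          = (\<Sum>c\<in>I i. \<Sum>e\<in>J i c. t i (c, e))"
        by (simp add: fls_times_nth(2) fls_nth_sum I_def J_def t_def)
      also have "\<dots> = (\<Sum>p\<in>(SIGMA c:I i. J i c). t i p)"
        by (subst sum.Sigma) (auto simp: I_def J_def)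
      also have "\<dots> = (\<Sum>p\<in>T. t i p)"
        by (rule sum.mono_neutral_left) (use fin supp that in \<open>auto simp: T_def\<close>)
      finally show ?thesis .
    qed
    have summand: "fps_nth (case p of (c, e) \<Rightarrow> cf F (c, e) * cf G (a - c, b - e)) d = (\<Sum>i=0..d. t i p)" for p
      by (auto simp: fps_mult_nth cf_nth t_def split: prod.splits)
    have "fps_nth (cf (F * G) (a, b)) d = (\<Sum>i=0..d. \<Sum>p\<in>T. t i p)"
      by (simp add: cf_nth fps_mult_nth fls_nth_sum inner)
    also have "\<dots> = (\<Sum>p\<in>T. \<Sum>i=0..d. t i p)" by (rule sum.swap)
    also have "\<dots> = fps_nth (lmul (cf F) (cf G) (a, b)) d"
      unfolding lmul_def prod.case
    proof (subst tsum_nth[OF fin])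
      fix p assume "fps_nth (case p of (c, e) \<Rightarrow> cf F (c, e) * cf G (a - c, b - e)) d \<noteq> 0"
      then obtain i where "i \<in> {0..d}" "t i p \<noteq> 0" unfolding summand by (metis sum.not_neutral_contains_not_neutral)
      then show "p \<in> T" using supp unfolding T_def by blast
    qed (simp add: summand)
    finally show "fps_nth (cf (F * G) (a, b)) d = fps_nth (lmul (cf F) (cf G) (a, b)) d" .
  qed
qed

definition cst :: "ser \<Rightarrow> biser" where
  "cst c = Abs_fps (\<lambda>d. fls_const (fls_const (fps_nth c d)))"
definition U1 :: biser where "U1 = fps_const fls_X"
definition U1i :: biser where "U1i = fps_const fls_X_inv"
definition U2 :: biser where "U2 = fps_const (fls_const fls_X)"
definition U2i :: biser where "U2i = fps_const (fls_const fls_X_inv)"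

lemma cf_eqI: "(\<And>a b d. fls_nth (fls_nth (fps_nth F d) a) b = fps_nth (g (a, b)) d) \<Longrightarrow> cf F = g"
  by (auto simp: fun_eq_iff fps_eq_iff cf_nth)

lemma cf_cst: "cf (cst c) = lconst c"
  by (rule cf_eqI) (auto simp: cst_def lconst_def lmono_def)
lemma cf_U: "cf U1 = u1" "cf U1i = u1inv" "cf U2 = u2" "cf U2i = u2inv"
  by (auto intro!: cf_eqI simp: U1_def U1i_def U2_def U2i_def u1_def u2_def u1inv_def u2inv_def lmono_def)
lemma cf_1: "cf 1 = lone"
  by (rule cf_eqI) (auto simp: lone_def lconst_def lmono_def)
lemma cf_add: "cf (F + G) = ladd (cf F) (cf G)"
  by (rule cf_eqI) (auto simp: ladd_def cf_nth)
lemma cf_neg: "cf (- F) = lneg (cf F)"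
  by (rule cf_eqI) (auto simp: lneg_def cf_nth)
lemma cf_sub: "cf (F - G) = lsub (cf F) (cf G)"
  unfolding lsub_def cf_neg[symmetric] cf_add[symmetric] by simp
lemma cf_pow: "cf (F ^ m) = lpow (cf F) m"
  by (induction m) (simp_all add: cf_1 cf_mult)
lemma cf_prod: "cf (\<Prod>j\<in>{1..<n+1}. F j) = lprod [1..<n+1] (\<lambda>j. cf (F j))"
proof -
  have "cf (prod_list (map F is)) = lprod is (\<lambda>j. cf (F j))" for "is" :: "nat list"
    by (induction "is") (simp_all add: lprod_def cf_1 cf_mult)
  moreover have "prod F {1..<n+1} = prod_list (map F [1..<n+1])"
    using prod.distinct_set_conv_list[OF distinct_upt] set_upt by metis
  ultimately show ?thesis by metis
qed

lemma cst_0: "cst 0 = 0" and cst_1: "cst 1 = 1" and cst_add: "cst (x + y) = cst x + cst y"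
  and cst_diff: "cst (x - y) = cst x - cst y" and cst_neg: "cst (- x) = - cst x"
  by (auto simp: cst_def fps_eq_iff fls_eq_iff)
lemma fls_const_sum: "fls_const (sum f A) = (\<Sum>x\<in>A. fls_const (f x))"
  by (induction A rule: infinite_finite_induct) (auto simp: fls_plus_const[symmetric])
lemma cst_mult: "cst (x * y) = cst x * cst y"
  by (auto simp: cst_def fps_eq_iff fps_mult_nth fls_const_sum)
lemma cst_prod: "cst (prod f A) = (\<Prod>x\<in>A. cst (f x))"
  by (induction A rule: infinite_finite_induct) (auto simp: cst_1 cst_mult)
lemma cst_power: "cst (x ^ k) = cst x ^ k"
  by (induction k) (auto simp: cst_1 cst_mult)
lemmas cst_simps = cst_0 cst_1 cst_add cst_diff cst_neg cst_mult cst_prod cst_power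

lemma U_inv: "U1 * U1i = 1" "U2 * U2i = 1"
proof -
  have "(fls_X::'a::comm_ring_1 fls) * fls_X_inv = 1"
    by (simp add: fls_X_times_conv_shift fls_eq_iff)
  then show "U1 * U1i = 1" "U2 * U2i = 1"
    by (simp_all add: U1_def U1i_def U2_def U2i_def fps_const_mult[symmetric] del: fps_const_mult)
       (simp_all add: mult.commute[of fls_X_inv])
qed

lemma cf_cst_mult: "cf (cst c * F) p = c * cf F p"
proof -
  obtain a b where p: "p = (a, b)" by force
  show ?thesis unfolding cf_mult cf_cst lmul_def p prod.case
    by (subst tsum_single[of "(0,0)"]) (auto simp: lconst_def lmono_def split: if_splits)
qed

lemma cf_U1_mult: "cf (U1 * F) (a, b) = cf F (a - 1, b)"
  unfolding cf_mult cf_U lmul_def prod.case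
  by (subst tsum_single[of "(1,0)"]) (auto simp: u1_def lmono_def split: if_splits)
lemma cf_U2_mult: "cf (U2 * F) (a, b) = cf F (a, b - 1)"
  unfolding cf_mult cf_U lmul_def prod.case
  by (subst tsum_single[of "(0,1)"]) (auto simp: u2_def lmono_def split: if_splits)

lemma cf_U1_power_mult: "cf (U1 ^ m * F) (a, b) = cf F (a - int m, b)"
proof (induction m arbitrary: a)
  case (Suc m)
  have "U1 ^ Suc m * F = U1 * (U1 ^ m * F)" by (simp only: power_Suc mult.assoc)
  then show ?case by (simp only: cf_U1_mult Suc) (simp add: algebra_simps)
qed simp

lemma cf_U2_power_mult: "cf (U2 ^ m * F) (a, b) = cf F (a, b - int m)"
proof (induction m arbitrary: b)
  case (Suc m)
  have "U2 ^ Suc m * F = U2 * (U2 ^ m * F)" by (simp only: power_Suc mult.assoc)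
  then show ?case by (simp only: cf_U2_mult Suc) (simp add: algebra_simps)
qed simp

text \<open>In \<open>van\<close> the bound M may depend on the exponents as well as on the degree.
  This covers both kinds of geometric series in the definitions: those that converge in the grading,
  and the one in the kernel, which converges only in powers of u_1.\<close>

lemma cf_linv1:
  assumes I: "I * (1 + E) = 1"
    and van: "\<And>a b d. \<exists>M. \<forall>m\<ge>M. fps_nth (cf (I * (- E) ^ m) (a, b)) d = 0"
  shows "cf I = linv1 (cf E)"
proof (rule cf_eqI)
  fix a b d
  obtain M where M: "\<And>m. m \<ge> M \<Longrightarrow> fps_nth (cf (I * (- E) ^ m) (a, b)) d = 0"
    using van by blast
  \<comment> \<open>The terms of the series are differences of consecutive remainders I (-E)^m, so
    they vanish where the remainders do.\<close>
  have van2: "fps_nth (cf ((- E) ^ m) (a, b)) d = 0" if "m \<ge> M" for m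
  proof -
    have "(- E) ^ m = (I * (1 + E)) * (- E) ^ m" by (simp add: I)
    also have "\<dots> = I * (- E) ^ m - I * (- E) ^ Suc m" by (simp add: algebra_simps)
    finally have "fps_nth (cf ((- E) ^ m) (a, b)) d
        = fps_nth (cf (I * (- E) ^ m - I * (- E) ^ Suc m) (a, b)) d" by (rule arg_cong)
    then show ?thesis using M[of m] M[of "Suc m"] that by (simp add: cf_nth)
  qed
  have "I = (\<Sum>m<k. (- E) ^ m) + I * (- E) ^ k" for k
  proof (induction k)
    case (Suc k)
    have "I * (- E) ^ k = I * (1 + E) * (- E) ^ k + I * (- E) ^ Suc k"
      by (simp add: algebra_simps)
    then have "I * (- E) ^ k = (- E) ^ k + I * (- E) ^ Suc k" by (simp add: I)
    then show ?case using Suc by (simp only: sum.lessThan_Suc add.assoc)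
  qed simp
  from this[of M] have "fps_nth (cf I (a, b)) d = fps_nth (cf ((\<Sum>m<M. (- E) ^ m) + I * (- E) ^ M) (a, b)) d"
    by (rule arg_cong)
  also have "\<dots> = (\<Sum>m<M. fps_nth (cf ((- E) ^ m) (a, b)) d)"
    using M[of M] by (simp add: cf_nth fps_sum_nth fls_nth_sum)
  also have "\<dots> = fps_nth (linv1 (cf E) (a, b)) d"
    unfolding linv1_def lsum_def cf_neg[symmetric] cf_pow[symmetric]
    by (subst tsum_nth[of "{..<M}"]) (use van2 not_le in auto)
  finally show "fls_nth (fls_nth (fps_nth I d) a) b = fps_nth (linv1 (cf E) (a, b)) d"
    by (simp add: cf_nth)
qed

section \<open>Series without negative powers of one of the variables\<close>

definition reg1 :: "biser set" where "reg1 = {F. \<forall>a b. a < 0 \<longrightarrow> cf F (a, b) = 0}"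
definition reg2 :: "biser set" where "reg2 = {F. \<forall>a b. b < 0 \<longrightarrow> cf F (a, b) = 0}"

lemma reg_mult: "F \<in> reg1 \<Longrightarrow> G \<in> reg1 \<Longrightarrow> F * G \<in> reg1"
  "F \<in> reg2 \<Longrightarrow> G \<in> reg2 \<Longrightarrow> F * G \<in> reg2"
proof -
  show "F * G \<in> reg1" if "F \<in> reg1" "G \<in> reg1"
    unfolding reg1_def mem_Collect_eq cf_mult lmul_def prod.case
  proof (intro allI impI)
    fix a b :: int assume a: "a < 0"
    have "(\<lambda>(c, e). cf F (c, e) * cf G (a - c, b - e)) = (\<lambda>_. 0)"
    proof (rule ext, rule prod.induct, unfold prod.case)
      fix c e :: int
      have "c < 0 \<or> a - c < 0" using a by linarith
      then show "cf F (c, e) * cf G (a - c, b - e) = 0" using that by (auto simp: reg1_def)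
    qed
    then show "tsum (\<lambda>(c, e). cf F (c, e) * cf G (a - c, b - e)) UNIV = 0" by (simp only: tsum_zero)
  qed
  show "F * G \<in> reg2" if "F \<in> reg2" "G \<in> reg2"
    unfolding reg2_def mem_Collect_eq cf_mult lmul_def prod.case
  proof (intro allI impI)
    fix a b :: int assume b: "b < 0"
    have "(\<lambda>(c, e). cf F (c, e) * cf G (a - c, b - e)) = (\<lambda>_. 0)"
    proof (rule ext, rule prod.induct, unfold prod.case)
      fix c e :: int
      have "e < 0 \<or> b - e < 0" using b by linarith
      then show "cf F (c, e) * cf G (a - c, b - e) = 0" using that by (auto simp: reg2_def)
    qed
    then show "tsum (\<lambda>(c, e). cf F (c, e) * cf G (a - c, b - e)) UNIV = 0" by (simp only: tsum_zero)
  qed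
qed

lemma reg_basic: "cst c \<in> reg1" "cst c \<in> reg2" "U1 \<in> reg1" "U1 \<in> reg2" "U2 \<in> reg1" "U2 \<in> reg2"
  "U2i \<in> reg1" "U1i \<in> reg2" "1 \<in> reg1" "1 \<in> reg2"
  by (auto simp: reg1_def reg2_def cf_cst cf_U cf_1 lone_def lconst_def lmono_def u1_def u2_def
      u1inv_def u2inv_def)

lemma reg_add: "F \<in> reg1 \<Longrightarrow> G \<in> reg1 \<Longrightarrow> F + G \<in> reg1" "F \<in> reg2 \<Longrightarrow> G \<in> reg2 \<Longrightarrow> F + G \<in> reg2"
  "F \<in> reg1 \<Longrightarrow> G \<in> reg1 \<Longrightarrow> F - G \<in> reg1" "F \<in> reg2 \<Longrightarrow> G \<in> reg2 \<Longrightarrow> F - G \<in> reg2"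
  "F \<in> reg1 \<Longrightarrow> - F \<in> reg1" "F \<in> reg2 \<Longrightarrow> - F \<in> reg2"
  by (auto simp: reg1_def reg2_def cf_add cf_neg cf_sub ladd_def lneg_def lsub_def)

lemma reg_power: "F \<in> reg1 \<Longrightarrow> F ^ k \<in> reg1" "F \<in> reg2 \<Longrightarrow> F ^ k \<in> reg2"
  by (induction k) (auto intro: reg_mult reg_basic)

lemma reg_prod: "(\<And>x. x \<in> A \<Longrightarrow> F x \<in> reg1) \<Longrightarrow> prod F A \<in> reg1"
   "(\<And>x. x \<in> A \<Longrightarrow> F x \<in> reg2) \<Longrightarrow> prod F A \<in> reg2"
  by (induction A rule: infinite_finite_induct) (auto intro: reg_mult reg_basic)

lemmas regI = reg_mult reg_basic reg_add reg_power reg_prod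

text \<open>Regularity is a condition on single coefficients, so it passes from the powers of E to
  the infinite geometric series.\<close>

lemma reg_linv1:
  assumes "cf I = linv1 (cf E)"
  shows "E \<in> reg1 \<Longrightarrow> I \<in> reg1" "E \<in> reg2 \<Longrightarrow> I \<in> reg2"
proof -
  have "cf I p = tsum (\<lambda>m. cf ((- E) ^ m) p) UNIV" for p
    unfolding assms linv1_def lsum_def cf_neg[symmetric] cf_pow[symmetric] by simp
  moreover have "E \<in> reg1 \<Longrightarrow> (- E) ^ m \<in> reg1" "E \<in> reg2 \<Longrightarrow> (- E) ^ m \<in> reg2" for m
    by (auto intro: regI)
  ultimately show "E \<in> reg1 \<Longrightarrow> I \<in> reg1" "E \<in> reg2 \<Longrightarrow> I \<in> reg2"
    by (auto simp: reg1_def reg2_def tsum_zero)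
qed

text \<open>Meant for E without a part of degree 0, where the geometric series converges in the
  grading. The factor 1 + u_1/u_2 of the kernel is not of this kind.\<close>

definition inv1 :: "'a::comm_ring_1 fps \<Rightarrow> 'a fps" where
  "inv1 E = fps_right_inverse (1 + E) 1"

lemma inv1_mult: "fps_nth E 0 = 0 \<Longrightarrow> inv1 E * (1 + E) = 1"
  unfolding inv1_def by (subst mult.commute, rule fps_right_inverse) simp

lemma cf_inv1:
  assumes E: "fps_nth E 0 = 0"
  shows "cf (inv1 E) = linv1 (cf E)"
proof (rule cf_linv1[OF inv1_mult[OF E]])
  fix a b d
  have "fps_nth (inv1 E * (- E) ^ m) d = 0" if "m \<ge> Suc d" for m
  proof -
    have "\<forall>k<m. fps_nth ((- E) ^ m) k = 0" by (rule startsby_zero_power_prefix) (simp add: E)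
    then show ?thesis using that by (simp add: fps_mult_nth)
  qed
  then show "\<exists>M. \<forall>m\<ge>M. fps_nth (cf (inv1 E * (- E) ^ m) (a, b)) d = 0"
    by (intro exI[of _ "Suc d"]) (simp add: cf_nth)
qed

subsection \<open>Residues of the generating functions\<close>

lemma cst_var_nth_0: "fps_nth (cst (var i)) 0 = 0" "fps_nth (cst beta) 0 = 0"
  by (simp_all add: cst_def var_def beta_def)

lemma cf_inv1_beta: "cf (inv1 (cst beta * U)) = linv1 (lmul (lconst beta) (cf U))"
  by (subst cf_inv1) (simp_all add: cst_var_nth_0 cf_mult cf_cst)

lemma cf_inv1_xv: "cf (inv1 (- (cst (xv j) * U))) = linv1 (lneg (lmul (lconst (xv j)) (cf U)))"
  by (subst cf_inv1) (simp_all add: cst_var_nth_0 cf_mult cf_cst cf_neg xv_def)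

definition bplus :: "biser \<Rightarrow> ser \<Rightarrow> biser" where
  "bplus U c = U + cst c + cst (beta * c) * U"

definition Gb :: "nat \<Rightarrow> nat \<Rightarrow> biser \<Rightarrow> biser \<Rightarrow> biser" where
  "Gb n q U Ui = inv1 (cst beta * U) *
     ((\<Prod>j\<in>{1..<n+1}. bplus U (xv j) * (cst (1 + beta * xv j) * (Ui * inv1 (- (cst (xv j) * Ui)))))
      * (\<Prod>k\<in>{1..<q+1}. bplus U (bv k) * Ui))"

lemma cf_bplus: "cf (bplus U c) = lfgl_plus (cf U) c"
  by (simp add: bplus_def lfgl_plus_def cf_add cf_mult cf_cst)

lemma cf_Gb: "cf (Gb n q U Ui) = Gq n q (cf U) (cf Ui)"
  unfolding Gb_def Gq_def cf_mult cf_prod cf_bplus cf_cst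
  unfolding cf_inv1_beta cf_inv1_xv ..

definition V1 :: biser where "V1 = inv1 (cst beta * U1)"
definition V2 :: biser where "V2 = inv1 (cst beta * U2)"

lemma V_eq: "V1 * (1 + cst beta * U1) = 1" "V2 * (1 + cst beta * U2) = 1"
  unfolding V1_def V2_def by (rule inv1_mult, simp add: cst_var_nth_0)+

lemma cf_V: "cf V1 = linv1 (lmul (lconst beta) u1)" "cf V2 = linv1 (lmul (lconst beta) u2)"
  unfolding V1_def V2_def
  by (simp_all add: cf_inv1_beta cf_U)

lemma reg_V: "V1 \<in> reg1" "V1 \<in> reg2" "V2 \<in> reg1" "V2 \<in> reg2"
proof -
  have "cf V1 = linv1 (cf (cst beta * U1))" "cf V2 = linv1 (cf (cst beta * U2))"
    by (simp_all add: cf_V cf_mult cf_cst cf_U)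
  from reg_linv1[OF this(1)] reg_linv1[OF this(2)]
  show "V1 \<in> reg1" "V1 \<in> reg2" "V2 \<in> reg1" "V2 \<in> reg2" by (blast intro: regI)+
qed

text \<open>This is 1/(u - x) expanded in powers of x, with \<open>Ui\<close> standing for 1/u: a
  simple pole whose residue in u is 1.\<close>

definition Y :: "biser \<Rightarrow> ser \<Rightarrow> biser" where "Y Ui x = Ui * inv1 (- (cst x * Ui))"

lemma Y_eq:
  assumes "U * Ui = 1"
  shows "Y Ui (var i) * (U - cst (var i)) = 1"
proof -
  have "Y Ui (var i) * (U - cst (var i)) = inv1 (- (cst (var i) * Ui)) * (U * Ui + - (cst (var i) * Ui))"
    by (simp add: Y_def algebra_simps)
  also have "\<dots> = 1" unfolding assms
    by (rule inv1_mult) (simp add: cst_var_nth_0)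
  finally show ?thesis .
qed

text \<open>The resolvent identity for 1/(u - x), in multiplied form because x_i - x_j has no
  inverse among the series. It is what drives \<open>partial_fractions\<close>.\<close>

lemma Y_diff:
  assumes "U * Ui = 1"
  shows "cst (var i - var j) * (Y Ui (var i) * Y Ui (var j)) = Y Ui (var i) - Y Ui (var j)"
proof -
  let ?a = "Y Ui (var i)" and ?b = "Y Ui (var j)"
  have a: "?a * (U - cst (var i)) = 1" and b: "?b * (U - cst (var j)) = 1"
    using Y_eq[OF assms] by auto
  have "cst (var i - var j) * (?a * ?b) = ?a * (?b * (U - cst (var j))) - ?b * (?a * (U - cst (var i)))"
    by (simp add: cst_diff algebra_simps)
  then show ?thesis unfolding a b by simp
qed

lemma cf_inv1_U1i: "cf (inv1 (- (cst (var i) * U1i))) (c, e) = (if c \<le> 0 \<and> e = 0 then var i ^ nat (- c) else 0)"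
  and cf_inv1_U2i: "cf (inv1 (- (cst (var i) * U2i))) (c, e) = (if e \<le> 0 \<and> c = 0 then var i ^ nat (- e) else 0)"
proof -
  have const_power: "fls_const x ^ m = fls_const (x ^ m)" for x :: "mpoly fls" and m
    by (induction m) auto
  have p: "cf (U1i ^ m) (c, e) = (if c = - int m \<and> e = 0 then 1 else 0)"
    "cf (U2i ^ m) (c, e) = (if e = - int m \<and> c = 0 then 1 else 0)" for m
    by (auto simp: U1i_def U2i_def const_power cf_def fps_eq_iff)
  have 1: "cf ((cst (var i) * U1i) ^ m) (c, e) = (if c = - int m \<and> e = 0 then var i ^ m else 0)"
    and 2: "cf ((cst (var i) * U2i) ^ m) (c, e) = (if e = - int m \<and> c = 0 then var i ^ m else 0)" for m
    unfolding power_mult_distrib cst_power[symmetric] cf_cst_mult p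
    by auto
  have t: "fps_nth (- (cst (var i) * F)) 0 = 0" for F by (simp add: cst_var_nth_0)
  have A: "cf (inv1 (- (cst (var i) * F))) p = tsum (\<lambda>m. cf ((cst (var i) * F) ^ m) p) UNIV" for F p
    unfolding cf_inv1[OF t] linv1_def lsum_def cf_neg[symmetric] cf_pow[symmetric] by simp
  show "cf (inv1 (- (cst (var i) * U1i))) (c, e) = (if c \<le> 0 \<and> e = 0 then var i ^ nat (- c) else 0)"
    unfolding A 1 by (subst tsum_single[of "nat (- c)"]) auto
  show "cf (inv1 (- (cst (var i) * U2i))) (c, e) = (if e \<le> 0 \<and> c = 0 then var i ^ nat (- e) else 0)"
    unfolding A 2 by (subst tsum_single[of "nat (- e)"]) auto
qed

lemma reg_Y: "Y U1i (var i) \<in> reg2" "Y U2i (var i) \<in> reg1"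
  unfolding Y_def by (rule regI; auto simp: reg1_def reg2_def cf_inv1_U1i cf_inv1_U2i cf_U u1inv_def u2inv_def lmono_def)+

text \<open>Since the poles are expanded in powers of x, one coefficient gathers the residues at 0
  and at all x_j together. A series that is regular in either variable has residue 0.\<close>

definition Res :: "biser \<Rightarrow> ser" where "Res F = cf F (-1, -1)"

lemma Res_diff: "Res (F - G) = Res F - Res G"
  by (simp add: Res_def cf_sub lsub_def lneg_def ladd_def)
lemma Res_cst: "Res (cst c * F) = c * Res F"
  by (simp add: Res_def cf_cst_mult)
lemma Res_reg: "F \<in> reg1 \<Longrightarrow> Res F = 0" "F \<in> reg2 \<Longrightarrow> Res F = 0"
  by (simp_all add: Res_def reg1_def reg2_def)

lemma Res_Y_Y: "Res (Y U1i (var i) * Y U2i (var j)) = 1"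
proof -
  let ?F = "inv1 (- (cst (var i) * U1i)) * inv1 (- (cst (var j) * U2i))"
  have "cf ?F (0, 0) = cf (U1 * (U2 * (U1i * U2i * ?F))) (0, 0)"
  proof -
    have "U1 * (U2 * (U1i * U2i * ?F)) = (U1 * U1i) * (U2 * U2i) * ?F" by (simp add: algebra_simps)
    then show ?thesis by (simp only: U_inv mult_1_left)
  qed
  also have "\<dots> = Res (Y U1i (var i) * Y U2i (var j))"
    unfolding cf_U1_mult cf_U2_mult Res_def Y_def by (simp add: ac_simps)
  finally have "Res (Y U1i (var i) * Y U2i (var j)) = cf ?F (0, 0)" ..
  also have "\<dots> = 1" unfolding cf_mult lmul_def prod.case
    by (subst tsum_single[of "(0,0)"]) (auto simp: cf_inv1_U1i cf_inv1_U2i split: if_splits)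
  finally show ?thesis .
qed

text \<open>Congruence modulo \<open>u - x\<close>, i.e. evaluation at \<open>u = x\<close>, with a quotient that has no
  negative powers of \<open>u\<close>.\<close>

definition ev :: "biser set \<Rightarrow> biser \<Rightarrow> ser \<Rightarrow> biser \<Rightarrow> biser \<Rightarrow> bool" where
  "ev R U x h v \<longleftrightarrow> h \<in> R \<and> v \<in> R \<and> (\<exists>g\<in>R. h - v = (U - cst x) * g)"

lemma ev_mult:
  assumes "R = reg1 \<or> R = reg2" "ev R U x h v" "ev R U x k w"
  shows "ev R U x (h * k) (v * w)"
proof -
  from assms obtain g g' where g: "g \<in> R" "g' \<in> R" "h - v = (U - cst x) * g" "k - w = (U - cst x) * g'"
    and R: "h \<in> R" "v \<in> R" "k \<in> R" "w \<in> R"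
    unfolding ev_def by blast
  have "h * k - v * w = (h - v) * k + v * (k - w)" by (simp add: algebra_simps)
  also have "\<dots> = (U - cst x) * (g * k + v * g')" unfolding g by (simp add: algebra_simps)
  finally show ?thesis using assms(1) g R unfolding ev_def by (blast intro: regI)
qed

lemma ev_add:
  assumes "R = reg1 \<or> R = reg2" "ev R U x h v" "ev R U x k w"
  shows "ev R U x (h + k) (v + w)" "ev R U x (h - k) (v - w)"
proof -
  from assms obtain g g' where g: "g \<in> R" "g' \<in> R" "h - v = (U - cst x) * g" "k - w = (U - cst x) * g'"
    and R: "h \<in> R" "v \<in> R" "k \<in> R" "w \<in> R"
    unfolding ev_def by blast
  have "(h + k) - (v + w) = (h - v) + (k - w)" "(h - k) - (v - w) = (h - v) - (k - w)"
    by (simp_all add: algebra_simps)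
  then have "(h + k) - (v + w) = (U - cst x) * (g + g')" "(h - k) - (v - w) = (U - cst x) * (g - g')"
    unfolding g by (simp_all add: algebra_simps)
  then show "ev R U x (h + k) (v + w)" "ev R U x (h - k) (v - w)"
    using assms(1) g R unfolding ev_def by (blast intro: regI)+
qed

lemma ev_refl: "R = reg1 \<or> R = reg2 \<Longrightarrow> h \<in> R \<Longrightarrow> ev R U x h h"
  unfolding ev_def using reg_basic(1,2)[of 0] by (auto simp: cst_0 intro!: bexI[of _ 0])

lemma ev_U: "R = reg1 \<or> R = reg2 \<Longrightarrow> U \<in> R \<Longrightarrow> ev R U x U (cst x)"
  unfolding ev_def using reg_basic by (auto intro!: bexI[of _ 1])

lemma ev_prod:
  assumes "R = reg1 \<or> R = reg2" "\<And>i. i \<in> A \<Longrightarrow> ev R U x (f i) (g i)"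
  shows "ev R U x (prod f A) (prod g A)"
  using assms(2)
proof (induction A rule: infinite_finite_induct)
  case (insert a A)
  then show ?case by (auto intro!: ev_mult[OF assms(1)])
qed (use assms(1) reg_basic in \<open>auto intro!: ev_refl\<close>)

lemma ev_power:
  assumes "R = reg1 \<or> R = reg2" "ev R U x h v"
  shows "ev R U x (h ^ k) (v ^ k)"
  using ev_prod[OF assms(1), of "{..<k}" U x "\<lambda>_. h" "\<lambda>_. v"] assms(2) by simp

lemma ev_bplus:
  assumes "R = reg1 \<or> R = reg2" "U \<in> R"
  shows "ev R U x (bplus U c) (cst (fgl_plus beta x c))"
proof -
  have c: "cst y \<in> R" for y using assms(1) reg_basic by blast
  have "ev R U x (bplus U c) (cst x + cst c + cst (beta * c) * cst x)"
    unfolding bplus_def by (intro ev_add ev_mult ev_refl ev_U assms c)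
  moreover have "cst x + cst c + cst (beta * c) * cst x = cst (fgl_plus beta x c)"
    by (simp add: fgl_plus_def cst_simps algebra_simps)
  ultimately show ?thesis by simp
qed

definition W :: "ser \<Rightarrow> ser" where "W x = inv1 (beta * x)"

lemma W_eq: "W x * (1 + beta * x) = 1"
  unfolding W_def by (rule inv1_mult) (simp add: beta_def var_def)

text \<open>For two inverses, V - w = V w ((1 + beta x) - (1 + beta U)), and the bracket is -beta (U
  - x).\<close>

lemma ev_V:
  assumes R: "R = reg1 \<or> R = reg2" and U: "V \<in> R" and V: "V * (1 + cst beta * U) = 1"
  shows "ev R U x V (cst (W x))"
proof -
  have w: "cst (W x) * (1 + cst beta * cst x) = 1"
    using arg_cong[OF W_eq, of cst] by (simp add: cst_simps)
  have "V - cst (W x) = V * (cst (W x) * (1 + cst beta * cst x)) - cst (W x) * (V * (1 + cst beta * U))"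
    unfolding w V by simp
  also have "\<dots> = (U - cst x) * (- (cst beta * V * cst (W x)))" by (simp add: algebra_simps)
  finally show ?thesis unfolding ev_def using R U by (blast intro: regI)
qed

text \<open>The pole y cancels against the factor U - x of h - v, which leaves g r; this is regular
  in the variable of R, so its residue is 0. The factor r may still have poles in the other
  variable.\<close>

lemma Res_ev:
  assumes "R = reg1 \<or> R = reg2" "ev R U x h v" "r \<in> R" "y * (U - cst x) = 1"
  shows "Res (y * h * r) = Res (y * v * r)"
proof -
  from assms obtain g where g: "g \<in> R" "h - v = (U - cst x) * g" unfolding ev_def by blast
  have "y * h * r - y * v * r = y * (h - v) * r" by (simp add: algebra_simps)
  also have "\<dots> = g * r * (y * (U - cst x))" unfolding g by (simp add: algebra_simps)
  finally have "y * h * r - y * v * r = g * r" unfolding assms(4) by simp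
  moreover have "Res (g * r) = 0" using g(1) assms(1,3) Res_reg reg_mult by blast
  ultimately show ?thesis by (metis Res_diff right_minus_eq)
qed

text \<open>As u_1/u_2 has degree 0 in the grading, \<open>inv1\<close> alone cannot produce 1/(u_2
  (+) u_1). The part 1 + u_1/u_2 is inverted first, as a power series in u_1 over the Laurent series
  in u_2; the term beta u_1, which has positive degree, is corrected afterwards.\<close>

lemma kernel_ex: obtains Q where "Q * (U2 + U1 + cst beta * U1 * U2) = 1" "Q \<in> reg1"
    "cf ((U2 - U1) * (V1 * Q)) = kernel"
proof -
  define g :: "mpoly fls fps" where "g = 1 + fps_const fls_X_inv * fps_X"
  define j where "j = fps_right_inverse g 1"
  have gj: "g * j = 1" unfolding j_def by (rule fps_right_inverse) (simp add: g_def)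
  define J :: biser where "J = fps_const (fps_to_fls j)"
  have X: "fps_to_fls (fps_X :: mpoly fls fps) = fls_X" by (simp add: fls_eq_iff)
  have J: "(1 + U1 * U2i) * J = 1"
  proof -
    have "1 + U1 * U2i = fps_const (fps_to_fls g)"
      by (auto simp: U1_def U2i_def g_def fls_times_fps_to_fls X mult.commute fps_to_fls_nth fps_eq_iff)
    then show ?thesis by (simp add: J_def fls_times_fps_to_fls[symmetric] gj)
  qed
  have Jr: "J \<in> reg1" by (auto simp: reg1_def J_def cf_def fps_eq_iff)
  define E where "E = U1 * U2i + cst beta * U1"
  \<comment> \<open>Because J inverts 1 + u_1/u_2, one has 1 + E = (1 + u_1/u_2)(1 + beta J
    u_1).\<close>
  define D where "D = J * inv1 (cst beta * (J * U1))"
  have z: "fps_nth (cst beta * (J * U1)) 0 = 0" by (simp add: cst_var_nth_0)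
  have "D * (1 + E) = inv1 (cst beta * (J * U1)) * ((1 + U1 * U2i) * J + cst beta * (J * U1))"
    by (simp add: D_def E_def algebra_simps)
  then have D: "D * (1 + E) = 1" unfolding J using inv1_mult[OF z] by simp
  have Dr: "D \<in> reg1"
    unfolding D_def by (intro regI Jr reg_linv1(1)[OF cf_inv1[OF z]])
  have cD: "cf D = linv1 (cf E)"
  proof (rule cf_linv1[OF D])
    fix a b d
    \<comment> \<open>E is u_1 times 1/u_2 + beta, and D is regular in u_1, so the m-th remainder
      starts at u_1^m; from m = a + 1 on it lies beyond u_1^a.\<close>
    have "cf (D * (- E) ^ m) (a, b) = 0" if "m \<ge> nat (a + 1)" for m
    proof -
      define F where "F = D * (- (U2i + cst beta)) ^ m"
      have Fr: "F \<in> reg1" unfolding F_def by (intro regI Dr)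
      have "- E = U1 * (- (U2i + cst beta))" by (simp add: E_def algebra_simps)
      then have "D * (- E) ^ m = U1 ^ m * F"
        unfolding F_def by (simp only: power_mult_distrib) (simp add: algebra_simps)
      then show ?thesis using Fr that by (simp add: cf_U1_power_mult reg1_def)
    qed
    then show "\<exists>M. \<forall>m\<ge>M. fps_nth (cf (D * (- E) ^ m) (a, b)) d = 0"
      by (intro exI[of _ "nat (a + 1)"]) simp
  qed
  show thesis
  proof (rule that[of "U2i * D"])
    have "U2i * D * (U2 + U1 + cst beta * U1 * U2) = D * (U2 * U2i + U1 * U2i + cst beta * U1 * (U2 * U2i))"
      by (simp add: algebra_simps)
    also have "\<dots> = D * (1 + E)" unfolding U_inv E_def by (simp add: algebra_simps)
    finally show "U2i * D * (U2 + U1 + cst beta * U1 * U2) = 1" using D by simp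
    show "U2i * D \<in> reg1" by (intro regI Dr)
    show "cf ((U2 - U1) * (V1 * (U2i * D))) = kernel"
      unfolding kernel_def cf_mult cD cf_V E_def cf_sub cf_add cf_cst cf_U ..
  qed
qed

subsection \<open>Partial fractions\<close>

text \<open>The differences x_a - x_b are not invertible among the double series. The identity is
  therefore stated behind an additive map L into a field, where they become the nonzero X a - X b.
  In the application L is the residue and H the rest of the integrand.\<close>

lemma partial_fractions:
  fixes L :: "'r::comm_ring_1 \<Rightarrow> 'k::field" and X :: "'i \<Rightarrow> 'k" and c Y :: "'i \<Rightarrow> 'r"
  assumes diff: "\<And>F G. L (F - G) = L F - L G"
    and lin: "\<And>i j F. L ((c i - c j) * F) = (X i - X j) * L F"
    and Yd: "\<And>i j. (c i - c j) * (Y i * Y j) = Y i - Y j"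
    and "finite S" "S \<noteq> {}" "inj_on X S"
  shows "L ((\<Prod>a\<in>S. Y a) * H) = (\<Sum>a\<in>S. L (Y a * H) / (\<Prod>i\<in>S - {a}. X a - X i))"
  using assms(4-6)
proof (induction "card S" arbitrary: S rule: less_induct)
  case less
  show ?case
  proof (cases "\<exists>a. S = {a}")
    case True
    then show ?thesis by auto
  next
    case False
    then obtain p where p: "p \<in> S" using less.prems by blast
    then obtain q where q: "q \<in> S" "q \<noteq> p" using False by blast
    define T where "T = S - {p, q}"
    have S: "S = insert p (insert q T)" and T: "finite T" "p \<notin> T" "q \<notin> T"
      using p q less.prems by (auto simp: T_def)
    have X: "X a \<noteq> X b" if "a \<in> S" "b \<in> S" "a \<noteq> b" for a b
      using less.prems(3) that by (auto simp: inj_on_def)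
    define \<pi> where "\<pi> a = (\<Prod>i\<in>T - {a}. X a - X i)" for a
    have \<pi>: "\<pi> a \<noteq> 0" if "a \<in> S" for a
      unfolding \<pi>_def using T X that S by auto
    let ?l = "\<lambda>a. L (Y a * H)"
    have ih: "L ((\<Prod>a\<in>insert r T. Y a) * H) = ?l r / \<pi> r + (\<Sum>a\<in>T. ?l a / ((X a - X r) * \<pi> a))"
      if r: "r \<in> {p, q}" for r
    proof -
      have rT: "r \<notin> T" using r T by auto
      have "card (insert r T) < card S" using r T q by (auto simp: S)
      then have "L ((\<Prod>a\<in>insert r T. Y a) * H) = (\<Sum>a\<in>insert r T. ?l a / (\<Prod>i\<in>insert r T - {a}. X a - X i))"
        by (rule less.hyps) (use T r less.prems(3) in \<open>auto simp: S intro: inj_on_subset\<close>)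
      also have "\<dots> = ?l r / \<pi> r + (\<Sum>a\<in>T. ?l a / (\<Prod>i\<in>insert r T - {a}. X a - X i))"
        using rT T by (simp add: \<pi>_def)
      also have "(\<Sum>a\<in>T. ?l a / (\<Prod>i\<in>insert r T - {a}. X a - X i)) = (\<Sum>a\<in>T. ?l a / ((X a - X r) * \<pi> a))"
      proof (rule sum.cong[OF refl])
        fix a assume a: "a \<in> T"
        then have "insert r T - {a} = insert r (T - {a})" using rT by auto
        then show "?l a / (\<Prod>i\<in>insert r T - {a}. X a - X i) = ?l a / ((X a - X r) * \<pi> a)"
          using T rT by (simp add: \<pi>_def)
      qed
      finally show ?thesis .
    qed
    have pq: "X p - X q \<noteq> 0" using X p q by simp
    \<comment> \<open>Multiplying by X p - X q replaces the product over S by the difference of the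
      products over S without q and S without p, and the induction hypothesis covers both.\<close>
    have "(X p - X q) * L ((\<Prod>a\<in>S. Y a) * H) = L ((c p - c q) * ((\<Prod>a\<in>S. Y a) * H))"
      by (simp add: lin)
    also have "(c p - c q) * ((\<Prod>a\<in>S. Y a) * H) = ((c p - c q) * (Y p * Y q)) * (\<Prod>a\<in>T. Y a) * H"
      using T q by (simp add: S algebra_simps)
    also have "\<dots> = (\<Prod>a\<in>insert p T. Y a) * H - (\<Prod>a\<in>insert q T. Y a) * H"
      unfolding Yd using T by (simp add: algebra_simps)
    also have "L \<dots> = (?l p / \<pi> p + (\<Sum>a\<in>T. ?l a / ((X a - X p) * \<pi> a)))
        - (?l q / \<pi> q + (\<Sum>a\<in>T. ?l a / ((X a - X q) * \<pi> a)))"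
      unfolding diff using ih by simp
    also have "\<dots> = ?l p / \<pi> p - ?l q / \<pi> q + (\<Sum>a\<in>T. ?l a / ((X a - X p) * \<pi> a) - ?l a / ((X a - X q) * \<pi> a))"
      by (simp add: sum_subtractf)
    also have "(\<Sum>a\<in>T. ?l a / ((X a - X p) * \<pi> a) - ?l a / ((X a - X q) * \<pi> a))
        = (\<Sum>a\<in>T. (X p - X q) * (?l a / ((X a - X p) * (X a - X q) * \<pi> a)))"
    proof (rule sum.cong[OF refl])
      fix a assume a: "a \<in> T"
      have "\<pi> a \<noteq> 0" "X a - X p \<noteq> 0" "X a - X q \<noteq> 0" using \<pi> X a T S by auto
      moreover have "A / (u * P) - A / (v * P) = (v - u) * (A / (u * v * P))"
        if "u \<noteq> 0" "v \<noteq> 0" "P \<noteq> 0" for A P u v :: 'k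
        using that by (simp add: field_simps)
      ultimately show "?l a / ((X a - X p) * \<pi> a) - ?l a / ((X a - X q) * \<pi> a)
          = (X p - X q) * (?l a / ((X a - X p) * (X a - X q) * \<pi> a))"
        by simp
    qed
    also have "?l p / \<pi> p - ?l q / \<pi> q + (\<Sum>a\<in>T. (X p - X q) * (?l a / ((X a - X p) * (X a - X q) * \<pi> a)))
      = (X p - X q) * (?l p / ((X p - X q) * \<pi> p) + (?l q / ((X q - X p) * \<pi> q)
         + (\<Sum>a\<in>T. ?l a / ((X a - X p) * (X a - X q) * \<pi> a))))"
    proof -
      have "?l p / \<pi> p = (X p - X q) * (?l p / ((X p - X q) * \<pi> p))" using pq by simp
      moreover have "- (?l q / \<pi> q) = (X p - X q) * (?l q / ((X q - X p) * \<pi> q))"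
        using pq \<pi>[of q] q by (simp add: field_simps)
      ultimately show ?thesis by (simp add: distrib_left sum_distrib_left)
    qed
    finally have main: "L ((\<Prod>a\<in>S. Y a) * H) = ?l p / ((X p - X q) * \<pi> p) + (?l q / ((X q - X p) * \<pi> q)
         + (\<Sum>a\<in>T. ?l a / ((X a - X p) * (X a - X q) * \<pi> a)))"
      using pq by simp
    have "(\<Prod>i\<in>S - {p}. X p - X i) = (X p - X q) * \<pi> p" "(\<Prod>i\<in>S - {q}. X q - X i) = (X q - X p) * \<pi> q"
    proof -
      have "S - {p} = insert q (T - {p})" "S - {q} = insert p (T - {q})" using S T q by auto
      then show "(\<Prod>i\<in>S - {p}. X p - X i) = (X p - X q) * \<pi> p"
        "(\<Prod>i\<in>S - {q}. X q - X i) = (X q - X p) * \<pi> q"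
        using T by (simp_all add: \<pi>_def)
    qed
    moreover have "(\<Prod>i\<in>S - {a}. X a - X i) = (X a - X p) * (X a - X q) * \<pi> a" if a: "a \<in> T" for a
    proof -
      have "S - {a} = insert p (insert q (T - {a}))" using S T q a by auto
      then show ?thesis using T q by (simp add: \<pi>_def)
    qed
    ultimately have "(\<Sum>a\<in>S. ?l a / (\<Prod>i\<in>S - {a}. X a - X i)) =
      ?l p / ((X p - X q) * \<pi> p) + (?l q / ((X q - X p) * \<pi> q)
         + (\<Sum>a\<in>T. ?l a / ((X a - X p) * (X a - X q) * \<pi> a)))"
      using T q by (simp add: S)
    then show ?thesis using main by simp
  qed
qed

section \<open>The fraction field and its nonzero denominators\<close>

lemma emb_simps: "emb (f + g) = emb f + emb g" "emb (f - g) = emb f - emb g" "emb (f * g) = emb f * emb g"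
  "emb 0 = 0" "emb 1 = 1" "emb (- f) = - emb f"
  by (simp_all add: emb_def Zero_fract_def One_fract_def)

lemma emb_eq_0_iff: "emb f = 0 \<longleftrightarrow> f = 0"
  by (simp add: emb_def Zero_fract_def eq_fract)

lemma emb_prod: "emb (prod f A) = (\<Prod>x\<in>A. emb (f x))"
  and emb_sum: "emb (sum f A) = (\<Sum>x\<in>A. emb (f x))"
  by (induction A rule: infinite_finite_induct) (auto simp: emb_simps)

lemma emb_power: "emb (f ^ k) = emb f ^ k"
  by (induction k) (auto simp: emb_simps)

lemma emb_of_int: "emb (of_int k) = of_int k"
proof -
  have "emb (of_nat k) = of_nat k" for k by (induction k) (auto simp: emb_simps)
  then show ?thesis by (cases k rule: int_diff_cases) (simp add: emb_simps)
qed

lemma emb_fgl_plus: "emb (fgl_plus b x y) = fgl_plus (emb b) (emb x) (emb y)"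
  by (simp add: fgl_plus_def emb_simps)

lemma lookup_pvar: "Poly_Mapping.lookup (pvar i) (Poly_Mapping.single j 1) = (if i = j then 1 else 0)"
proof -
  have "Poly_Mapping.single i (1::nat) = Poly_Mapping.single j 1 \<longleftrightarrow> i = j" for i j :: nat
    by (metis lookup_single_eq lookup_single_not_eq one_neq_zero)
  then show ?thesis by (simp add: pvar_def lookup_single when_def)
qed

lemma var_nth: "fps_nth (var i) 0 = 0" "fps_nth (var i) (Suc 0) = pvar i"
  by (simp_all add: var_def)

lemma xv_diff_nz: "a \<noteq> b \<Longrightarrow> xv a - xv b \<noteq> 0"
proof
  assume "a \<noteq> b" "xv a - xv b = 0"
  then have "fps_nth (xv a - xv b) (Suc 0) = 0" by simp
  then have "Poly_Mapping.lookup (pvar (2*a)) (Poly_Mapping.single (2*a) 1) = Poly_Mapping.lookup (pvar (2*b)) (Poly_Mapping.single (2*a) 1)"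
    by (simp add: xv_def var_nth)
  then show False using \<open>a \<noteq> b\<close> unfolding lookup_pvar by simp
qed

text \<open>The part of degree 1 is x_a + x_b, as beta x_a x_b sits in degree 3; its coefficient of
  x_a is 1 or, for a = b, 2.\<close>

lemma fgl_plus_nz: "fgl_plus beta (xv a) (xv b) \<noteq> 0"
proof
  assume "fgl_plus beta (xv a) (xv b) = 0"
  then have "fps_nth (fgl_plus beta (xv a) (xv b)) (Suc 0) = 0" by simp
  then have "pvar (2*a) + pvar (2*b) = 0"
    by (simp add: xv_def beta_def var_nth fgl_plus_def)
  then have "Poly_Mapping.lookup (pvar (2*a) + pvar (2*b)) (Poly_Mapping.single (2*a) 1) = 0" by simp
  then show False unfolding lookup_add lookup_pvar by (simp split: if_splits)
qed

lemma one_plus_beta_nz: "1 + beta * x \<noteq> 0" "2 + beta * x \<noteq> 0"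
proof -
  have "fps_nth (1 + beta * x) 0 = 1" "fps_nth (2 + beta * x) 0 = 2"
    by (simp_all add: beta_def var_nth fps_numeral_nth)
  then show "1 + beta * x \<noteq> 0" "2 + beta * x \<noteq> 0"
    by (metis fps_zero_nth one_neq_zero, metis fps_zero_nth zero_neq_numeral)
qed

text \<open>The factor u^q absorbs the q denominators u of the b-factors, after which the only poles
  are u = x_1, ..., x_n. This is how the upper index nu - 1 and the exponent nu fit together: the
  u^-(q+1) coefficient of G^(q) is the u^-1 coefficient of u^q G^(q).\<close>

lemma Gb_shift:
  assumes U: "U * Ui = 1"
  shows "U ^ q * Gb n q U Ui = (\<Prod>a\<in>{1..n}. Y Ui (xv a)) * (cst (\<Prod>j\<in>{1..n}. 1 + beta * xv j)
     * inv1 (cst beta * U) * (\<Prod>j\<in>{1..n}. bplus U (xv j)) * (\<Prod>k\<in>{1..q}. bplus U (bv k)))"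
proof -
  have set: "{1..<k+1} = {1..k}" for k :: nat by auto
  have "U ^ q * Ui ^ q = 1" by (simp add: power_mult_distrib[symmetric] U)
  moreover have "Gb n q U Ui = Ui ^ q * ((\<Prod>a\<in>{1..n}. Y Ui (xv a)) * (cst (\<Prod>j\<in>{1..n}. 1 + beta * xv j)
     * inv1 (cst beta * U) * (\<Prod>j\<in>{1..n}. bplus U (xv j)) * (\<Prod>k\<in>{1..q}. bplus U (bv k))))"
    unfolding Gb_def set Y_def prod.distrib cst_prod by (simp add: mult_ac)
  ultimately show ?thesis by (simp add: mult.assoc[symmetric])
qed

text \<open>Q is regular in u_1 but not in u_2, which dictates the order. At u_1 = x_a the factor
  u_2 (+) x_a of G(u_2) cancels Q, and what is left is regular in u_2 and can be evaluated at x_b.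
  Hence the factor j = a is missing for b on the right, and the 1/(1 + beta u_1) of the kernel
  raises the exponent of \<open>W (xv a)\<close>.\<close>

lemma Res_Y_Y_eval:
  assumes a: "a \<in> {1..n}" and Q: "Q * (U2 + U1 + cst beta * U1 * U2) = 1" "Q \<in> reg1"
  shows "Res (Y U1i (xv a) * (Y U2i (xv b) *
      (cst C * V1 ^ s * (\<Prod>j\<in>{1..n}. bplus U1 (xv j)) * (\<Prod>k\<in>{1..p}. bplus U1 (bv k))
      * (cst C * V2 ^ r * (\<Prod>j\<in>{1..n}. bplus U2 (xv j)) * (\<Prod>k\<in>{1..q}. bplus U2 (bv k)))
      * ((U2 - U1) * (V1 * Q)))))
    = C * W (xv a) ^ Suc s * (\<Prod>j\<in>{1..n}. fgl_plus beta (xv a) (xv j)) * (\<Prod>k\<in>{1..p}. fgl_plus beta (xv a) (bv k))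
      * (C * W (xv b) ^ r * (\<Prod>j\<in>{1..n}-{a}. fgl_plus beta (xv b) (xv j)) * (\<Prod>k\<in>{1..q}. fgl_plus beta (xv b) (bv k)))
      * (xv b - xv a)" (is "?lhs = ?rhs")
proof -
  have reg: "reg1 = reg1 \<or> reg1 = reg2" "reg2 = reg1 \<or> reg2 = reg2" by auto
  have Y1: "Y U1i (xv a) * (U1 - cst (xv a)) = 1" and Y2: "Y U2i (xv b) * (U2 - cst (xv b)) = 1"
    unfolding xv_def by (rule Y_eq, rule U_inv)+
  let ?h1 = "cst C * V1 ^ Suc s * (\<Prod>j\<in>{1..n}. bplus U1 (xv j)) * (\<Prod>k\<in>{1..p}. bplus U1 (bv k))"
  let ?v1 = "C * W (xv a) ^ Suc s * (\<Prod>j\<in>{1..n}. fgl_plus beta (xv a) (xv j)) * (\<Prod>k\<in>{1..p}. fgl_plus beta (xv a) (bv k))"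
  let ?h2 = "cst C * V2 ^ r * (\<Prod>j\<in>{1..n}-{a}. bplus U2 (xv j)) * (\<Prod>k\<in>{1..q}. bplus U2 (bv k))"
  let ?v2 = "C * W (xv b) ^ r * (\<Prod>j\<in>{1..n}-{a}. fgl_plus beta (xv b) (xv j)) * (\<Prod>k\<in>{1..q}. fgl_plus beta (xv b) (bv k))"
  have bp: "bplus U2 c \<in> reg1" "bplus U2 c \<in> reg2" for c unfolding bplus_def by (intro regI)+
  have h2: "?h2 \<in> reg1" by (intro regI reg_V bp)
  have e1: "ev reg1 U1 (xv a) ?h1 (cst ?v1)"
    unfolding cst_mult cst_prod cst_power
    by (intro ev_mult ev_prod ev_power ev_bplus ev_V ev_refl reg reg_V V_eq reg_basic)
  have e2: "ev reg2 U2 (xv b) ?h2 (cst ?v2)"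
    unfolding cst_mult cst_prod cst_power
    by (intro ev_mult ev_prod ev_power ev_bplus ev_V ev_refl reg reg_V V_eq reg_basic)
  \<comment> \<open>At u_1 = x_a the series u_2 (+) x_a and u_2 (+) u_1 agree, and Q inverts the
    latter.\<close>
  have e3: "ev reg1 U1 (xv a) (bplus U2 (xv a) * Q) 1"
  proof -
    have "bplus U2 (xv a) * Q - 1 = bplus U2 (xv a) * Q - Q * (U2 + U1 + cst beta * U1 * U2)"
      by (simp add: Q)
    also have "\<dots> = (U1 - cst (xv a)) * (- (Q * (1 + cst beta * U2)))"
      by (simp add: bplus_def cst_mult algebra_simps)
    finally show ?thesis unfolding ev_def using Q(2) bp by (blast intro: regI)
  qed
  have e4: "ev reg1 U1 (xv a) (U2 - U1) (U2 - cst (xv a))"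
    by (intro ev_add ev_refl ev_U reg reg_basic)
  have e5: "ev reg2 U2 (xv b) (U2 - cst (xv a)) (cst (xv b - xv a))"
    unfolding cst_diff by (intro ev_add ev_refl ev_U reg reg_basic)
  have split: "(\<Prod>j\<in>{1..n}. bplus U2 (xv j)) = bplus U2 (xv a) * (\<Prod>j\<in>{1..n}-{a}. bplus U2 (xv j))"
    using a by (simp add: prod.remove)
  have "?lhs = Res (Y U1i (xv a) * (?h1 * ((U2 - U1) * (bplus U2 (xv a) * Q))) * (Y U2i (xv b) * ?h2))"
    unfolding split power_Suc by (simp add: mult_ac)
  also have "\<dots> = Res (Y U1i (xv a) * (cst ?v1 * ((U2 - cst (xv a)) * 1)) * (Y U2i (xv b) * ?h2))"
    by (rule Res_ev[OF reg(1) _ _ Y1], (intro ev_mult reg e1 e3 e4), intro regI h2, simp add: xv_def reg_Y)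
  also have "\<dots> = Res (Y U2i (xv b) * (?h2 * (U2 - cst (xv a))) * (Y U1i (xv a) * cst ?v1))"
    by (simp add: mult_ac)
  also have "\<dots> = Res (Y U2i (xv b) * (cst ?v2 * cst (xv b - xv a)) * (Y U1i (xv a) * cst ?v1))"
    by (rule Res_ev[OF reg(2) _ _ Y2], (intro ev_mult reg e2 e5), intro regI, simp add: xv_def reg_Y)
  also have "\<dots> = Res (cst ?rhs * (Y U1i (xv a) * Y U2i (xv b)))"
    unfolding cst_mult by (simp add: mult_ac)
  also have "\<dots> = ?rhs" unfolding Res_cst by (simp add: xv_def Res_Y_Y)
  finally show ?thesis .
qed

text \<open>The residue of u^p G^(p)(u) at u = x_a without its factor 1/(1 + beta x_a). The first
  product collects the numerators of 1/(u (-) x_j) = (1 + beta x_j)/(u - x_j).\<close>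

definition Acoef :: "nat \<Rightarrow> nat \<Rightarrow> nat \<Rightarrow> rat_fun" where
  "Acoef n p a = (\<Prod>j\<in>{1..n}. 1 + emb beta * emb (xv j)) *
     (\<Prod>j\<in>{1..n}. fgl_plus (emb beta) (emb (xv a)) (emb (xv j))) *
     (\<Prod>k\<in>{1..p}. fgl_plus (emb beta) (emb (xv a)) (emb (bv k))) /
     (\<Prod>j\<in>{1..n}-{a}. emb (xv a) - emb (xv j))"

text \<open>\<open>V1 ^ s\<close> and \<open>V2 ^ r\<close> stand for the two binomial sums. G adds
  one to each exponent and the kernel one more to that of x_a, hence s + 2 against r + 1.\<close>

lemma entry:
  assumes n: "n \<ge> 1" and Q: "Q * (U2 + U1 + cst beta * U1 * U2) = 1" "Q \<in> reg1"
  shows "emb (cf (V1 ^ s * V2 ^ r * (Gb n p U1 U1i * (Gb n q U2 U2i * ((U2 - U1) * (V1 * Q)))))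
        (- int (Suc p), - int (Suc q))) =
     (\<Sum>a\<in>{1..n}. \<Sum>b\<in>{1..n}. Acoef n p a * emb (W (xv a)) ^ (s + 2) * (Acoef n q b * emb (W (xv b)) ^ (r + 1))
        * ((emb (xv b) - emb (xv a)) / fgl_plus (emb beta) (emb (xv b)) (emb (xv a))))"
proof -
  let ?C = "\<Prod>j\<in>{1..n}. 1 + beta * xv j"
  let ?H = "cst ?C * V1 ^ Suc s * (\<Prod>j\<in>{1..n}. bplus U1 (xv j)) * (\<Prod>k\<in>{1..p}. bplus U1 (bv k))
      * (cst ?C * V2 ^ Suc r * (\<Prod>j\<in>{1..n}. bplus U2 (xv j)) * (\<Prod>k\<in>{1..q}. bplus U2 (bv k)))
      * ((U2 - U1) * (V1 * Q))"
  let ?F = "V1 ^ s * V2 ^ r * (Gb n p U1 U1i * (Gb n q U2 U2i * ((U2 - U1) * (V1 * Q))))"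
  let ?P1 = "\<Prod>a\<in>{1..n}. Y U1i (xv a)" and ?P2 = "\<Prod>a\<in>{1..n}. Y U2i (xv a)"
  let ?X = "\<lambda>a. emb (xv a)"
  have "cf ?F (- int (Suc p), - int (Suc q)) = Res (U1 ^ p * (U2 ^ q * ?F))"
    unfolding Res_def cf_U1_power_mult cf_U2_power_mult by (simp add: algebra_simps)
  also have "U1 ^ p * (U2 ^ q * ?F) = V1 ^ s * V2 ^ r * ((U1 ^ p * Gb n p U1 U1i) * ((U2 ^ q * Gb n q U2 U2i) * ((U2 - U1) * (V1 * Q))))"
    by (simp add: mult_ac)
  also have "\<dots> = ?P1 * (?P2 * ?H)"
    unfolding Gb_shift[OF U_inv(1)] Gb_shift[OF U_inv(2)] V1_def[symmetric] V2_def[symmetric]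
    by (simp add: mult_ac)
  finally have 1: "cf ?F (- int (Suc p), - int (Suc q)) = Res (?P1 * (?P2 * ?H))" .
  have inj: "inj_on ?X {1..n}"
  proof (rule inj_onI)
    fix a b assume "?X a = ?X b"
    then have "emb (xv a - xv b) = 0" by (simp add: emb_simps)
    then show "a = b" using xv_diff_nz emb_eq_0_iff by blast
  qed
  have pf: "emb (Res ((\<Prod>a\<in>{1..n}. Y Ui (xv a)) * H)) =
      (\<Sum>a\<in>{1..n}. emb (Res (Y Ui (xv a) * H)) / (\<Prod>i\<in>{1..n} - {a}. ?X a - ?X i))"
    if U: "U * Ui = 1" for U Ui H
  proof (rule partial_fractions[where c="\<lambda>a. cst (xv a)"])
    show "emb (Res (F - G)) = emb (Res F) - emb (Res G)" for F G by (simp add: Res_diff emb_simps)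
    show "emb (Res ((cst (xv i) - cst (xv j)) * F)) = (?X i - ?X j) * emb (Res F)" for i j F
      by (simp add: cst_diff[symmetric] Res_cst emb_simps)
    show "(cst (xv i) - cst (xv j)) * (Y Ui (xv i) * Y Ui (xv j)) = Y Ui (xv i) - Y Ui (xv j)" for i j
      unfolding cst_diff[symmetric] unfolding xv_def by (rule Y_diff[OF U])
  qed (use n inj in auto)
  let ?d = "\<lambda>a. \<Prod>i\<in>{1..n} - {a}. ?X a - ?X i"
  let ?R = "\<lambda>a b. emb (Res (Y U1i (xv a) * (Y U2i (xv b) * ?H)))"
  have "emb (Res (?P1 * (?P2 * ?H))) = (\<Sum>a\<in>{1..n}. emb (Res (?P2 * (Y U1i (xv a) * ?H))) / ?d a)"
    unfolding pf[OF U_inv(1)] by (simp only: mult.left_commute)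
  also have "\<dots> = (\<Sum>a\<in>{1..n}. \<Sum>b\<in>{1..n}. ?R a b / ?d b / ?d a)"
    unfolding pf[OF U_inv(2)] sum_divide_distrib by (simp only: mult.left_commute)
  also have "\<dots> = (\<Sum>a\<in>{1..n}. \<Sum>b\<in>{1..n}. Acoef n p a * emb (W (xv a)) ^ (s + 2) * (Acoef n q b * emb (W (xv b)) ^ (r + 1))
        * ((emb (xv b) - emb (xv a)) / fgl_plus (emb beta) (emb (xv b)) (emb (xv a))))"
  proof (intro sum.cong refl)
    fix a b assume a: "a \<in> {1..n}"
    have nz: "fgl_plus (emb beta) (?X b) (?X a) \<noteq> 0"
      unfolding emb_fgl_plus[symmetric] emb_eq_0_iff by (rule fgl_plus_nz)
    have split: "(\<Prod>j\<in>{1..n}. fgl_plus (emb beta) (?X b) (?X j)) = fgl_plus (emb beta) (?X b) (?X a) *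
        (\<Prod>j\<in>{1..n}-{a}. fgl_plus (emb beta) (?X b) (?X j))"
      using a by (simp add: prod.remove)
    have e1: "r + 1 = Suc r" and e2: "s + 2 = Suc (Suc s)" by simp_all
    \<comment> \<open>Here f is x_b (+) x_a, the factor that cancelled in the residue: it is put
      back into \<open>Acoef n q b\<close> and divided out again in K.\<close>
    have arith: "(c * w1 * p1 * b1 * (c * w2 * p2 * b2) * x) / d2 / d1
        = (c * p1 * b1 / d1) * w1 * ((c * (f * p2) * b2 / d2) * w2) * (x / f)" if "f \<noteq> 0"
      for c w1 p1 b1 w2 p2 b2 d1 d2 x f :: rat_fun
      using that by (simp add: mult_ac)
    show "?R a b / ?d b / ?d a = Acoef n p a * emb (W (xv a)) ^ (s + 2) * (Acoef n q b * emb (W (xv b)) ^ (r + 1))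
        * ((emb (xv b) - emb (xv a)) / fgl_plus (emb beta) (emb (xv b)) (emb (xv a)))"
      unfolding Res_Y_Y_eval[OF a Q] Acoef_def split emb_simps emb_prod emb_power emb_fgl_plus e2 e1
      by (rule arith[OF nz])
  qed
  finally show ?thesis unfolding 1 .
qed

subsection \<open>The matrix entries\<close>

lemma zbinom_0: "zbinom N 0 = 1" "zbinom 0 (Suc k) = 0"
  by (simp_all add: zbinom_def prod.atLeast0_lessThan_Suc_shift del: prod.op_ivl_Suc)

text \<open>The integer division hides Pascal's rule, so it is imported from generalised binomial
  coefficients over the rationals.\<close>

lemma zbinom_Suc_Suc: "zbinom (N + 1) (Suc k) = zbinom N k + zbinom N (Suc k)"
proof -
  have z: "of_int (zbinom N k) = (of_int N gchoose k :: rat)" for N k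
  proof -
    show ?thesis unfolding zbinom_def
      by (rule of_int_gbinomial[of N k, unfolded gbinomial_prod_rev[where 'a = int]])
  qed
  have "(of_int (zbinom (N + 1) (Suc k)) :: rat) = of_int (zbinom N k + zbinom N (Suc k))"
    by (simp only: z of_int_add of_int_1 gbinomial_Suc_Suc)
  then show ?thesis by (simp only: of_int_eq_iff)
qed

text \<open>The coefficient of u^a in (1 + beta u)^(-s).\<close>

definition vpow :: "nat \<Rightarrow> int \<Rightarrow> ser" where
  "vpow s a = (if a < 0 then 0 else of_int (zbinom (- int s) (nat a)) * beta ^ nat a)"

lemma vpow_0: "vpow 0 a = (if a = 0 then 1 else 0)"
proof (cases "a \<le> 0")
  case False
  then obtain k where "nat a = Suc k" using not0_implies_Suc[of "nat a"] by auto
  then show ?thesis using False by (simp add: vpow_def zbinom_0)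
qed (auto simp: vpow_def zbinom_0)

text \<open>In terms of generating series, (1 + beta u) h is c times (1 + beta u)^(-s) and h has no
  negative powers of u. The recursion then determines h, and Pascal's rule identifies it.\<close>

lemma vpow_Suc:
  assumes "\<And>b. b < 0 \<Longrightarrow> h b = 0" "\<And>b. h b + beta * h (b - 1) = c * vpow s b"
  shows "h b = c * vpow (Suc s) b"
proof (cases "b < 0")
  case False
  have "h (int k) = c * vpow (Suc s) (int k)" for k
  proof (induction k)
    case 0
    then show ?case using assms(1)[of "-1"] assms(2)[of 0] by (simp add: vpow_def zbinom_0)
  next
    case (Suc k)
    have "h (int (Suc k)) = c * vpow s (int (Suc k)) - beta * h (int k)"
      using assms(2)[of "int (Suc k)"] by (simp add: algebra_simps)
    also have "\<dots> = c * ((of_int (zbinom (- int s) (Suc k)) - of_int (zbinom (- int (Suc s)) k)) * beta ^ Suc k)"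
      by (simp add: Suc vpow_def nat_add_distrib algebra_simps)
    also have "of_int (zbinom (- int s) (Suc k)) - of_int (zbinom (- int (Suc s)) k)
        = (of_int (zbinom (- int (Suc s)) (Suc k)) :: ser)"
      using zbinom_Suc_Suc[of "- int (Suc s)" k] by simp
    also have "c * (\<dots> * beta ^ Suc k) = c * vpow (Suc s) (int (Suc k))"
      by (simp add: vpow_def nat_add_distrib)
    finally show ?case .
  qed
  from this[of "nat b"] False show ?thesis by simp
qed (use assms(1) in \<open>simp add: vpow_def\<close>)

lemma cf_V_power: "cf (V1 ^ s * V2 ^ r) (a, b) = vpow s a * vpow r b"
proof -
  have V2: "cf (V2 ^ r) (a, b) = vpow 0 a * vpow r b" for a b
  proof (induction r arbitrary: b)
    case 0
    then show ?case by (simp add: cf_1 lone_def lconst_def lmono_def vpow_0)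
  next
    case (Suc r)
    show ?case
    proof (rule vpow_Suc)
      have "V2 ^ Suc r \<in> reg2" by (intro regI reg_V)
      then show "cf (V2 ^ Suc r) (a, b) = 0" if "b < 0" for b using that by (simp add: reg2_def)
      fix b
      have "V2 ^ r = V2 ^ Suc r + cst beta * (U2 * V2 ^ Suc r)"
        using arg_cong[OF V_eq(2), of "\<lambda>x. x * V2 ^ r"] by (simp add: algebra_simps)
      then have "cf (V2 ^ r) (a, b) = cf (V2 ^ Suc r + cst beta * (U2 * V2 ^ Suc r)) (a, b)" by simp
      then show "cf (V2 ^ Suc r) (a, b) + beta * cf (V2 ^ Suc r) (a, b - 1) = vpow 0 a * vpow r b"
        by (simp only: cf_add ladd_def cf_cst_mult cf_U2_mult Suc)
    qed
  qed
  show ?thesis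
  proof (induction s arbitrary: a)
    case 0
    then show ?case by (simp add: V2)
  next
    case (Suc s)
    have "cf (V1 ^ Suc s * V2 ^ r) (a, b) = vpow r b * vpow (Suc s) a"
    proof (rule vpow_Suc)
      have "V1 ^ Suc s * V2 ^ r \<in> reg1" by (intro regI reg_V)
      then show "cf (V1 ^ Suc s * V2 ^ r) (a, b) = 0" if "a < 0" for a using that by (simp add: reg1_def)
      fix a
      have "V1 ^ s * V2 ^ r = V1 ^ Suc s * V2 ^ r + cst beta * (U1 * (V1 ^ Suc s * V2 ^ r))"
        using arg_cong[OF V_eq(1), of "\<lambda>x. x * (V1 ^ s * V2 ^ r)"] by (simp add: algebra_simps)
      then have "cf (V1 ^ s * V2 ^ r) (a, b)
          = cf (V1 ^ Suc s * V2 ^ r + cst beta * (U1 * (V1 ^ Suc s * V2 ^ r))) (a, b)" by simp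
      then show "cf (V1 ^ Suc s * V2 ^ r) (a, b) + beta * cf (V1 ^ Suc s * V2 ^ r) (a - 1, b)
          = vpow r b * vpow s a"
        by (simp only: cf_add ladd_def cf_cst_mult cf_U1_mult Suc mult.commute)
    qed
    then show ?case by (simp add: mult.commute)
  qed
qed

text \<open>Multiplication by (1 + beta u)^(-s) moves the coefficient at u^-(p+k) to u^-p with
  weight binom(-s,k) beta^k. The convolution runs over all integer exponents; since
  \<open>vpow\<close> vanishes below 0 it reduces to the natural indices k and l.\<close>

lemma tsum_zbinom:
  assumes F: "\<And>k l. G k l = cf F (- int k, - int l)"
  shows "tsum (\<lambda>(k, l). of_int (zbinom (- int s) k * zbinom (- int r) l) * beta ^ (k + l) * G (p + k) (q + l)) UNIV
    = cf (V1 ^ s * V2 ^ r * F) (- int p, - int q)"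
proof -
  let ?h = "\<lambda>(k, l). (int k, int l)"
  let ?f = "\<lambda>(c, e). cf (V1 ^ s * V2 ^ r) (c, e) * cf F (- int p - c, - int q - e)"
  have "tsum ?f UNIV = tsum (?f \<circ> ?h) UNIV"
  proof (rule tsum_reindex)
    show "inj ?h" by (auto simp: inj_def)
    fix i :: "int \<times> int" assume i: "i \<notin> range ?h"
    obtain c e where ce: "i = (c, e)" by force
    have "c < 0 \<or> e < 0"
    proof (rule ccontr)
      assume "\<not> (c < 0 \<or> e < 0)"
      then have "i = ?h (nat c, nat e)" by (simp add: ce)
      then show False using i by blast
    qed
    then show "?f i = 0" by (auto simp: ce cf_V_power vpow_def)
  qed
  also have "?f \<circ> ?h = (\<lambda>(k, l). of_int (zbinom (- int s) k * zbinom (- int r) l) * beta ^ (k + l) * G (p + k) (q + l))"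
    by (auto simp: fun_eq_iff cf_V_power vpow_def F power_add)
  finally show ?thesis unfolding cf_mult[of _ F] lmul_def prod.case by simp
qed

text \<open>The exponent depends on the position i alone and not on whether i is the row or the
  column of an entry, as the multilinear expansion of the Pfaffian requires.\<close>

definition Pcoef :: "nat \<Rightarrow> nat \<Rightarrow> (nat \<Rightarrow> nat) \<Rightarrow> nat \<Rightarrow> nat \<Rightarrow> rat_fun" where
  "Pcoef n m nu i a = Acoef n (nu i - 1) a * emb (W (xv a)) ^ (2 * m + 1 - i)"

definition Kcoef :: "nat \<Rightarrow> nat \<Rightarrow> rat_fun" where
  "Kcoef a b = (emb (xv b) - emb (xv a)) / fgl_plus (emb beta) (emb (xv b)) (emb (xv a))"

lemma matrix_entry:
  assumes "n \<ge> 1" "i < j" "j \<le> 2 * m" "0 < nu i" "0 < nu j"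
  shows "emb (tsum (\<lambda>(k, l). of_int (zbinom (int i + 1 - 2 * int m) k * zbinom (int j - 2 * int m) l)
                      * beta ^ (k + l) * GQpq n (nu i) (nu j) (nu i + k) (nu j + l)) UNIV)
     = (\<Sum>a\<in>{1..n}. \<Sum>b\<in>{1..n}. Pcoef n m nu i a * (Pcoef n m nu j b * Kcoef a b))"
proof -
  obtain Q where Q: "Q * (U2 + U1 + cst beta * U1 * U2) = 1" "Q \<in> reg1"
    and ker: "cf ((U2 - U1) * (V1 * Q)) = kernel"
    by (rule kernel_ex)
  let ?F = "Gb n (nu i - 1) U1 U1i * (Gb n (nu j - 1) U2 U2i * ((U2 - U1) * (V1 * Q)))"
  have G: "GQpq n (nu i) (nu j) k l = cf ?F (- int k, - int l)" for k l
    unfolding GQpq_def cf_mult[of "Gb n (nu i - 1) U1 U1i"] cf_mult[of "Gb n (nu j - 1) U2 U2i"]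
      cf_Gb cf_U ker ..
  \<comment> \<open>From i < j and j <= 2m both binomial tops are nonpositive, so the subtractions
    of naturals are exact.\<close>
  have i: "int i + 1 - 2 * int m = - int (2 * m - 1 - i)" and j: "int j - 2 * int m = - int (2 * m - j)"
    using assms by auto
  have e: "- int (nu i) = - int (Suc (nu i - 1))" "- int (nu j) = - int (Suc (nu j - 1))"
    using assms by auto
  \<comment> \<open>With s = 2m-1-i and r = 2m-j, the exponents s + 2 and r + 1 take the common form
    2m+1-t: the shift between the two binomial tops pays for the extra factor of the kernel.\<close>
  have s: "2 * m - 1 - i + 2 = 2 * m + 1 - i" "2 * m - j + 1 = 2 * m + 1 - j" using assms by auto
  show ?thesis
    unfolding i j tsum_zbinom[where G="GQpq n (nu i) (nu j)", OF G]
    unfolding e entry[OF assms(1) Q] s Pcoef_def Kcoef_def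
    by (simp add: mult_ac)
qed

subsection \<open>Multilinear expansion of the Pfaffian\<close>

definition matchings :: "nat \<Rightarrow> (nat \<Rightarrow> nat) set" where
  "matchings m = {s. s permutes {1..2*m} \<and> (\<forall>i\<in>{1..m}. s (2*i - 1) < s (2*i))
                 \<and> (\<forall>i\<in>{1..<m}. s (2*i - 1) < s (2*i + 1))}"

lemma pfaffian_alt: "pfaffian m M =
    (\<Sum>s\<in>matchings m. of_int (sign s) * (\<Prod>i\<in>{1..m}. M (s (2*i - 1)) (s (2*i))))"
  by (simp add: pfaffian_def matchings_def)

lemma matchings_range:
  assumes "s \<in> matchings m" "i \<in> {1..m}"
  shows "s (2*i - 1) \<in> {1..2*m}" "s (2*i) \<in> {1..2*m}" "s (2*i - 1) < s (2*i)"
proof -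
  have s: "s permutes {1..2*m}" and lt: "s (2*i - 1) < s (2*i)" using assms by (auto simp: matchings_def)
  have "2*i - 1 \<in> {1..2*m}" "2*i \<in> {1..2*m}" using assms(2) by auto
  then show "s (2*i - 1) \<in> {1..2*m}" "s (2*i) \<in> {1..2*m}" "s (2*i - 1) < s (2*i)"
    using permutes_in_image[OF s] lt by blast+
qed

text \<open>A matching reads only entries with row < column, and \<open>matrix_entry\<close> holds
  only for those.\<close>

lemma pfaffian_cong:
  assumes "\<And>i j. 1 \<le> i \<Longrightarrow> i < j \<Longrightarrow> j \<le> 2*m \<Longrightarrow> M i j = N i j"
  shows "pfaffian m M = pfaffian m N"
  unfolding pfaffian_alt
proof (intro sum.cong arg_cong2[where f="(*)"] prod.cong refl)
  fix s i assume "s \<in> matchings m" "i \<in> {1..m}"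
  from matchings_range[OF this] show "M (s (2*i - 1)) (s (2*i)) = N (s (2*i - 1)) (s (2*i))"
    by (intro assms) auto
qed

lemma emb_pfaffian: "emb (pfaffian m M) = pfaffian m (\<lambda>i j. emb (M i j))"
  by (simp add: pfaffian_alt emb_sum emb_prod emb_simps emb_of_int)

lemma prod_pairs: "(\<Prod>t\<in>{1..2*m}. F t) = (\<Prod>i\<in>{1..m}. F (2*i - 1) * F (2*i::nat))"
  by (induction m) (simp_all add: mult_ac)

lemma sum_PiE_insert:
  assumes "x \<notin> S"
  shows "(\<Sum>f\<in>PiE (insert x S) (\<lambda>_. A). F f) = (\<Sum>a\<in>A. \<Sum>f\<in>PiE S (\<lambda>_. A). F (f(x := a)))"
proof -
  have "(\<Sum>f\<in>PiE (insert x S) (\<lambda>_. A). F f)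
      = (\<Sum>p\<in>A \<times> PiE S (\<lambda>_. A). F ((\<lambda>(y, g). g(x := y)) p))"
    unfolding PiE_insert_eq by (rule sum.reindex_cong[OF inj_combinator[OF assms] refl refl])
  then show ?thesis by (simp add: sum.cartesian_product case_prod_beta)
qed

text \<open>In use, \<open>\<alpha>\<close> is the permutation of a matching. Functions live on its
  image rather than on {1..2m}, so that the induction can add one pair of points at a time: the
  first values of a permutation need not form an initial segment.\<close>

lemma prod_sum_sum_PiE:
  fixes \<alpha> :: "nat \<Rightarrow> 'b" and g :: "nat \<Rightarrow> 'a \<Rightarrow> 'a \<Rightarrow> 'r::comm_semiring_1"
  assumes "inj_on \<alpha> {1..2*m}"
  shows "(\<Prod>i\<in>{1..m}. \<Sum>a\<in>A. \<Sum>b\<in>A. g i a b)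
    = (\<Sum>f\<in>PiE (\<alpha> ` {1..2*m}) (\<lambda>_. A). \<Prod>i\<in>{1..m}. g i (f (\<alpha> (2*i - 1))) (f (\<alpha> (2*i))))"
  using assms
proof (induction m)
  case (Suc m)
  let ?S = "\<alpha> ` {1..2*m}" and ?x = "\<alpha> (2*m+1)" and ?y = "\<alpha> (2*m+2)"
  let ?F = "\<lambda>f. \<Prod>i\<in>{1..m}. g i (f (\<alpha> (2*i - 1))) (f (\<alpha> (2*i)))"
  have inj: "\<alpha> a = \<alpha> b \<longleftrightarrow> a = b" if "a \<in> {1..2*Suc m}" "b \<in> {1..2*Suc m}" for a b
    using Suc.prems that by (auto simp: inj_on_def)
  have nin: "?x \<notin> insert ?y ?S" "?y \<notin> ?S"
    using inj by (auto simp: image_iff)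
  have "{1..2 * Suc m} = insert (2*m+1) (insert (2*m+2) {1..2*m})" by auto
  then have im: "\<alpha> ` {1..2 * Suc m} = insert ?x (insert ?y ?S)" by simp
  have IH: "(\<Prod>i\<in>{1..m}. \<Sum>a\<in>A. \<Sum>b\<in>A. g i a b) = (\<Sum>f\<in>PiE ?S (\<lambda>_. A). ?F f)"
    by (rule Suc.IH, rule inj_on_subset[OF Suc.prems]) auto
  have upd: "(\<Prod>i\<in>{1..Suc m}. g i ((f(?y := b, ?x := a)) (\<alpha> (2*i - 1))) ((f(?y := b, ?x := a)) (\<alpha> (2*i))))
     = ?F f * g (Suc m) a b" for f a b
  proof -
    have "?F (f(?y := b, ?x := a)) = ?F f"
    proof (rule prod.cong[OF refl])
      fix i assume i: "i \<in> {1..m}"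
      have "\<alpha> k \<notin> {?x, ?y}" if "k \<in> {1..2*m}" for k
        using inj[of k "2*m+1"] inj[of k "2*m+2"] that by auto
      moreover have "2*i - 1 \<in> {1..2*m}" "2*i \<in> {1..2*m}" using i by auto
      ultimately have "\<alpha> (2*i - 1) \<notin> {?x, ?y}" "\<alpha> (2*i) \<notin> {?x, ?y}" by blast+
      then show "g i ((f(?y := b, ?x := a)) (\<alpha> (2*i - 1))) ((f(?y := b, ?x := a)) (\<alpha> (2*i)))
        = g i (f (\<alpha> (2*i - 1))) (f (\<alpha> (2*i)))" by simp
    qed
    moreover have "?x \<noteq> ?y" using nin by blast
    ultimately show ?thesis by (simp add: mult_ac)
  qed
  have "(\<Prod>i\<in>{1..Suc m}. \<Sum>a\<in>A. \<Sum>b\<in>A. g i a b)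
     = (\<Sum>f\<in>PiE ?S (\<lambda>_. A). ?F f) * (\<Sum>a\<in>A. \<Sum>b\<in>A. g (Suc m) a b)"
    using IH by (simp add: mult_ac)
  also have "\<dots> = (\<Sum>f\<in>PiE ?S (\<lambda>_. A). \<Sum>a\<in>A. \<Sum>b\<in>A. ?F f * g (Suc m) a b)"
    unfolding sum_distrib_right by (simp only: sum_distrib_left)
  also have "\<dots> = (\<Sum>a\<in>A. \<Sum>b\<in>A. \<Sum>f\<in>PiE ?S (\<lambda>_. A). ?F f * g (Suc m) a b)"
    by (subst sum.swap) (rule sum.cong[OF refl], rule sum.swap)
  finally show ?case unfolding im sum_PiE_insert[OF nin(1)] sum_PiE_insert[OF nin(2)] upd .
qed auto

lemma pfaffian_multilinear:
  fixes P :: "nat \<Rightarrow> 'a \<Rightarrow> 'r::comm_ring_1"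
  shows "pfaffian m (\<lambda>i j. \<Sum>a\<in>A. \<Sum>b\<in>A. P i a * (P j b * K a b))
    = (\<Sum>f\<in>PiE {1..2*m} (\<lambda>_. A). (\<Prod>t\<in>{1..2*m}. P t (f t)) * pfaffian m (\<lambda>i j. K (f i) (f j)))"
proof -
  have "(\<Prod>i\<in>{1..m}. \<Sum>a\<in>A. \<Sum>b\<in>A. P (s (2*i - 1)) a * (P (s (2*i)) b * K a b))
     = (\<Sum>f\<in>PiE {1..2*m} (\<lambda>_. A). (\<Prod>t\<in>{1..2*m}. P t (f t)) * (\<Prod>i\<in>{1..m}. K (f (s (2*i - 1))) (f (s (2*i)))))"
    if "s \<in> matchings m" for s
  proof -
    have s: "s permutes {1..2*m}" using that by (simp add: matchings_def)
    have "(\<Prod>i\<in>{1..m}. \<Sum>a\<in>A. \<Sum>b\<in>A. P (s (2*i - 1)) a * (P (s (2*i)) b * K a b))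
      = (\<Sum>f\<in>PiE (s ` {1..2*m}) (\<lambda>_. A). \<Prod>i\<in>{1..m}. P (s (2*i - 1)) (f (s (2*i - 1))) *
          (P (s (2*i)) (f (s (2*i))) * K (f (s (2*i - 1))) (f (s (2*i)))))"
      by (rule prod_sum_sum_PiE) (rule permutes_inj_on[OF s])
    also have "\<dots> = (\<Sum>f\<in>PiE {1..2*m} (\<lambda>_. A). (\<Prod>t\<in>{1..2*m}. P (s t) (f (s t))) * (\<Prod>i\<in>{1..m}. K (f (s (2*i - 1))) (f (s (2*i)))))"
      unfolding permutes_image[OF s] prod_pairs prod.distrib[symmetric] by (simp only: mult.assoc)
    \<comment> \<open>Reindexed by s, the product of the P is the same for every matching and so
      leaves the sum over s.\<close>
    also have "(\<lambda>f. \<Prod>t\<in>{1..2*m}. P (s t) (f (s t))) = (\<lambda>f. \<Prod>t\<in>{1..2*m}. P t (f t))"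
      by (rule ext) (rule prod.permute[OF s, unfolded comp_def, symmetric])
    finally show ?thesis by (simp only: fun_eq_iff)
  qed
  then have "pfaffian m (\<lambda>i j. \<Sum>a\<in>A. \<Sum>b\<in>A. P i a * (P j b * K a b))
     = (\<Sum>s\<in>matchings m. \<Sum>f\<in>PiE {1..2*m} (\<lambda>_. A). of_int (sign s) * ((\<Prod>t\<in>{1..2*m}. P t (f t))
          * (\<Prod>i\<in>{1..m}. K (f (s (2*i - 1))) (f (s (2*i))))))"
    unfolding pfaffian_alt sum_distrib_left[symmetric] by (intro sum.cong refl) simp
  also have "\<dots> = (\<Sum>f\<in>PiE {1..2*m} (\<lambda>_. A). \<Sum>s\<in>matchings m. of_int (sign s) * ((\<Prod>t\<in>{1..2*m}. P t (f t))
          * (\<Prod>i\<in>{1..m}. K (f (s (2*i - 1))) (f (s (2*i))))))"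
    by (rule sum.swap)
  finally show ?thesis
    unfolding pfaffian_alt sum_distrib_left by (simp only: mult.left_commute)
qed

subsection \<open>Schur's Pfaffian\<close>

text \<open>A polynomial of degree below card P equals its Lagrange interpolant on P. The unscaled
  basis polynomials are monic of degree card P - 1, so comparing that coefficient gives the
  sum.\<close>

lemma lagrange_lead_coeff:
  fixes p :: "'a::field poly"
  assumes "finite P" "degree p < card P"
  shows "coeff p (card P - 1) = (\<Sum>t\<in>P. poly p t / (\<Prod>t'\<in>P - {t}. t - t'))"
proof -
  define l where "l t = (\<Prod>t'\<in>P - {t}. [:- t', 1:])" for t
  have deg: "degree (l t) = card P - 1" and lc: "coeff (l t) (card P - 1) = 1" if "t \<in> P" for t
  proof -
    have "degree (l t) = (\<Sum>t'\<in>P - {t}. degree [:- t', 1:])"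
      unfolding l_def by (rule degree_prod_eq_sum_degree) auto
    then show d: "degree (l t) = card P - 1" using that assms(1) by simp
    have "lead_coeff (l t) = 1" unfolding l_def by (simp add: lead_coeff_prod)
    then show "coeff (l t) (card P - 1) = 1" by (simp add: d)
  qed
  have poly_l: "poly (l t) x = (\<Prod>t'\<in>P - {t}. x - t')" for t x
    by (simp add: l_def poly_prod)
  define q where "q = (\<Sum>t\<in>P. smult (poly p t / poly (l t) t) (l t))"
  have "p = q"
  proof (rule poly_eqI_degree[where A=P])
    fix x assume x: "x \<in> P"
    have "poly (l t) x = 0" if "t \<in> P - {x}" for t
      unfolding poly_l using that x assms(1) by auto
    then have "poly q x = poly p x / poly (l x) x * poly (l x) x"
      unfolding q_def poly_sum using x assms(1) by (subst sum.remove[of _ x]) auto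
    moreover have "poly (l x) x \<noteq> 0" unfolding poly_l using assms(1) by auto
    ultimately show "poly p x = poly q x" by simp
  next
    have "degree q \<le> card P - 1"
      unfolding q_def
    proof (rule degree_sum_le)
      fix t assume "t \<in> P"
      then show "degree (smult (poly p t / poly (l t) t) (l t)) \<le> card P - 1"
        using deg degree_smult_le[of _ "l t"] by metis
    qed (rule assms)
    then show "card P > degree q" using assms(2) by linarith
  qed (rule assms(2))
  then have "coeff p (card P - 1) = coeff q (card P - 1)" by simp
  also have "\<dots> = (\<Sum>t\<in>P. poly p t / (\<Prod>t'\<in>P - {t}. t - t'))"
    unfolding q_def coeff_sum by (intro sum.cong refl) (simp only: coeff_smult lc poly_l mult_1_right)
  finally show ?thesis .
qed

definition kap :: "'a::field \<Rightarrow> 'a \<Rightarrow> 'a" where "kap z w = (w - z) / (w + z)"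

lemma kap_swap: "kap w z = - kap z w"
  unfolding kap_def by (metis add.commute minus_diff_eq minus_divide_left)

lemma kap_same: "kap z z = 0" by (simp add: kap_def)

text \<open>Lagrange interpolation of the monic polynomial (t - y) prod (t + w) on Z together with 0
  and -y. The node 0 contributes 1, by oddness of card Z; the node -y contributes -2 times the
  right-hand side; each z in Z contributes twice its summand. As the leading coefficient is 1, the
  last two contributions cancel.\<close>

lemma kap_partial_fractions:
  assumes fin: "finite Z" and odd: "odd (card Z)" and y: "y + y \<noteq> 0"
    and yZ: "\<And>z. z \<in> Z \<Longrightarrow> z + y \<noteq> 0" and ZZ: "\<And>z w. z \<in> Z \<Longrightarrow> w \<in> Z \<Longrightarrow> z + w \<noteq> (0::'a::field)"
  shows "(\<Sum>z\<in>Z. kap y z / (\<Prod>w\<in>Z - {z}. kap w z)) = (\<Prod>z\<in>Z. kap y z)"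
proof -
  define g where "g = (\<Prod>w\<in>Z. [:w, 1:])"
  define p where "p = [:- y, 1:] * g"
  \<comment> \<open>The node 0 cancels the z in the factor z + z of p(z), and -y supplies the
    denominator z + y of \<open>kap y z\<close>.\<close>
  define P where "P = insert 0 (insert (- y) Z)"
  have two: "(2::'a) \<noteq> 0" and y0: "y \<noteq> 0" using y by auto
  have Z0: "0 \<notin> Z" using ZZ[of 0 0] by auto
  have yZ': "- y \<notin> Z" using yZ[of "- y"] by auto
  have cP: "card P = card Z + 2" unfolding P_def using fin Z0 yZ' y0 by simp
  have "degree g = (\<Sum>w\<in>Z. degree [:w, 1:])"
    unfolding g_def by (rule degree_prod_eq_sum_degree) auto
  then have dg: "degree g = card Z" by simp
  have lg: "lead_coeff g = 1" unfolding g_def by (simp add: lead_coeff_prod)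
  then have g0: "g \<noteq> 0" by auto
  have dp: "degree p = card Z + 1" unfolding p_def using g0 dg by (subst degree_mult_eq) auto
  have "lead_coeff p = 1" unfolding p_def lead_coeff_mult lg by simp
  then have "1 = coeff p (card P - 1)" by (simp add: dp cP)
  also have "\<dots> = (\<Sum>t\<in>P. poly p t / (\<Prod>t'\<in>P - {t}. t - t'))"
    by (rule lagrange_lead_coeff) (use fin cP dp in \<open>auto simp: P_def\<close>)
  also have "\<dots> = poly p 0 / (\<Prod>t'\<in>P - {0}. 0 - t') + (poly p (- y) / (\<Prod>t'\<in>P - {- y}. - y - t')
      + (\<Sum>t\<in>Z. poly p t / (\<Prod>t'\<in>P - {t}. t - t')))"
    unfolding P_def using fin Z0 yZ' y0 by simp
  also have "poly p 0 / (\<Prod>t'\<in>P - {0}. 0 - t') = 1"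
  proof -
    have "P - {0} = insert (- y) Z" using y0 Z0 by (auto simp: P_def)
    then have "(\<Prod>t'\<in>P - {0}. 0 - t') = y * (\<Prod>w\<in>Z. - w)" using fin yZ' by simp
    also have "(\<Prod>w\<in>Z. - w) = - (\<Prod>w\<in>Z. w)" using odd by (simp add: prod_uminus)
    finally show ?thesis using y0 Z0 fin by (simp add: p_def g_def poly_prod)
  qed
  also have "poly p (- y) / (\<Prod>t'\<in>P - {- y}. - y - t') = - 2 * (\<Prod>z\<in>Z. kap y z)"
  proof -
    have "P - {- y} = insert 0 Z" using y0 yZ' by (auto simp: P_def)
    then have "(\<Prod>t'\<in>P - {- y}. - y - t') = - y * (\<Prod>w\<in>Z. - y - w)" using fin Z0 by simp
    also have "(\<Prod>w\<in>Z. - y - w) = (\<Prod>w\<in>Z. - (w + y))" by (intro prod.cong refl) simp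
    also have "\<dots> = - (\<Prod>w\<in>Z. w + y)" unfolding prod_uminus using odd by simp
    finally have "poly p (- y) / (\<Prod>t'\<in>P - {- y}. - y - t')
        = - 2 * y * (\<Prod>w\<in>Z. w - y) / (y * (\<Prod>w\<in>Z. w + y))"
      by (simp add: p_def g_def poly_prod algebra_simps)
    then show ?thesis using y0 by (simp add: kap_def prod_dividef)
  qed
  also have "(\<Sum>t\<in>Z. poly p t / (\<Prod>t'\<in>P - {t}. t - t')) = (\<Sum>z\<in>Z. 2 * (kap y z / (\<Prod>w\<in>Z - {z}. kap w z)))"
  proof (rule sum.cong[OF refl])
    fix z assume z: "z \<in> Z"
    have z0: "z \<noteq> 0" using z Z0 by auto
    have "P - {z} = insert 0 (insert (- y) (Z - {z}))" using z Z0 yZ' by (auto simp: P_def)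
    then have den: "(\<Prod>t'\<in>P - {z}. z - t') = z * ((z + y) * (\<Prod>w\<in>Z-{z}. z - w))"
      using fin Z0 yZ' y0 by simp
    have "poly p z = (z - y) * (\<Prod>w\<in>Z. w + z)"
      by (simp add: p_def g_def poly_prod left_diff_distrib)
    also have "(\<Prod>w\<in>Z. w + z) = 2 * z * (\<Prod>w\<in>Z-{z}. z + w)"
      using fin z by (subst prod.remove[of Z z]) (auto simp: add.commute)
    finally have "poly p z / (\<Prod>t'\<in>P - {z}. z - t')
        = 2 * ((z - y) / (z + y) * ((\<Prod>w\<in>Z-{z}. z + w) / (\<Prod>w\<in>Z-{z}. z - w)))"
      unfolding den using z0 by (simp add: mult_ac)
    then show "poly p z / (\<Prod>t'\<in>P - {z}. z - t') = 2 * (kap y z / (\<Prod>w\<in>Z - {z}. kap w z))"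
      by (simp add: kap_def prod_dividef)
  qed
  finally have "2 * (\<Sum>z\<in>Z. kap y z / (\<Prod>w\<in>Z - {z}. kap w z)) = 2 * (\<Prod>z\<in>Z. kap y z)"
    by (simp add: sum_distrib_left)
  then show ?thesis using two by simp
qed

text \<open>The product side of Schur's identity, over lists because the recursion deletes entries
  by position.\<close>

fun kap_prod :: "'a::field list \<Rightarrow> 'a" where
  "kap_prod [] = 1"
| "kap_prod (z # zs) = (\<Prod>w\<leftarrow>zs. kap z w) * kap_prod zs"

lemma kap_prod_middle:
  "kap_prod (A @ z # B) = (\<Prod>a\<leftarrow>A. kap a z) * (\<Prod>b\<leftarrow>B. kap z b) * kap_prod (A @ B)"
  by (induction A) (simp_all add: mult_ac)

lemma kap_prod_not_distinct: "\<not> distinct zs \<Longrightarrow> kap_prod zs = 0"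
proof (induction zs)
  case (Cons z zs)
  show ?case
  proof (cases "z \<in> set zs")
    case True
    then have "0 \<in> set (map (kap z) zs)" using kap_same[of z] by (metis image_eqI set_map)
    then show ?thesis by (simp add: prod_list_zero_iff)
  qed (use Cons in simp)
qed simp

lemma prod_list_kap_swap: "(\<Prod>b\<leftarrow>B. kap z b) = (-1) ^ length B * (\<Prod>b\<leftarrow>B. kap b z)"
proof (induction B)
  case (Cons b B)
  then show ?case using kap_swap[of z b] by simp
qed simp

definition del_nth :: "nat \<Rightarrow> 'a list \<Rightarrow> 'a list" where
  "del_nth j zs = take j zs @ drop (Suc j) zs"

text \<open>Dividing the whole product by the factors that contain z_j turns this into
  \<open>kap_partial_fractions\<close>; that division needs distinct entries. Lists with repetitions
  are treated too, since non-injective maps f occur in the expansion of the Pfaffian.\<close>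

lemma kap_prod_expand:
  fixes zs :: "'a::field list"
  assumes odd: "odd (length zs)"
    and nz: "\<And>u v. u \<in> set (y # zs) \<Longrightarrow> v \<in> set (y # zs) \<Longrightarrow> u + v \<noteq> 0"
  shows "(\<Sum>j<length zs. (-1) ^ j * kap y (zs ! j) * kap_prod (del_nth j zs)) = kap_prod (y # zs)"
proof (cases "distinct zs")
  case True
  let ?n = "length zs"
  have kz: "kap w z \<noteq> 0" if "w \<in> set zs" "z \<in> set zs" "w \<noteq> z" for w z
    using that nz[of z w] by (simp add: kap_def)
  have del: "(-1) ^ j * kap_prod (del_nth j zs) = kap_prod zs / (\<Prod>w\<in>set zs - {zs ! j}. kap w (zs ! j))"
    if j: "j < ?n" for j
  proof -
    let ?A = "take j zs" and ?B = "drop (Suc j) zs" and ?z = "zs ! j"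
    have zs: "zs = ?A @ ?z # ?B" using j by (simp add: id_take_nth_drop)
    have d: "distinct (?A @ ?z # ?B)" using True zs by simp
    then have set: "set zs - {?z} = set (?A @ ?B)"
      by (subst zs) auto
    have "distinct (?A @ ?B)" using d by auto
    then have pr: "(\<Prod>w\<in>set zs - {?z}. kap w ?z) = (\<Prod>w\<leftarrow>?A @ ?B. kap w ?z)"
      unfolding set by (rule prod.distinct_set_conv_list)
    have nzp: "(\<Prod>w\<in>set zs - {?z}. kap w ?z) \<noteq> 0" using kz j by (auto simp del: nth_mem intro: nth_mem)
    have "kap_prod zs = (\<Prod>a\<leftarrow>?A. kap a ?z) * (\<Prod>b\<leftarrow>?B. kap ?z b) * kap_prod (?A @ ?B)"
      using kap_prod_middle[of ?A ?z ?B] zs by simp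
    also have "\<dots> = (-1) ^ length ?B * kap_prod (?A @ ?B) * (\<Prod>w\<leftarrow>?A @ ?B. kap w ?z)"
      unfolding prod_list_kap_swap by (simp add: mult_ac)
    \<comment> \<open>j + length B is length zs - 1, an even number.\<close>
    also have "(-1) ^ length ?B = ((-1) ^ j :: 'a)"
    proof -
      have "even (length ?B) = even j" using j odd by simp
      then show ?thesis by (simp add: minus_one_power_iff)
    qed
    finally show ?thesis using nzp unfolding pr del_nth_def by simp
  qed
  have "(\<Sum>j<?n. (-1) ^ j * kap y (zs ! j) * kap_prod (del_nth j zs))
      = (\<Sum>j<?n. kap_prod zs * (kap y (zs ! j) / (\<Prod>w\<in>set zs - {zs ! j}. kap w (zs ! j))))"
  proof (rule sum.cong[OF refl])
    fix j assume j: "j \<in> {..<?n}"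
    have "(-1) ^ j * kap y (zs ! j) * kap_prod (del_nth j zs)
      = kap y (zs ! j) * ((-1) ^ j * kap_prod (del_nth j zs))" by (simp only: mult_ac)
    also have "\<dots> = kap_prod zs * (kap y (zs ! j) / (\<Prod>w\<in>set zs - {zs ! j}. kap w (zs ! j)))"
      using del j by simp
    finally show "(-1) ^ j * kap y (zs ! j) * kap_prod (del_nth j zs)
      = kap_prod zs * (kap y (zs ! j) / (\<Prod>w\<in>set zs - {zs ! j}. kap w (zs ! j)))" .
  qed
  also have "\<dots> = (\<Sum>z\<in>set zs. kap_prod zs * (kap y z / (\<Prod>w\<in>set zs - {z}. kap w z)))"
    by (rule sum.reindex_bij_betw) (simp add: bij_betw_nth[OF True])
  also have "\<dots> = kap_prod zs * (\<Prod>z\<in>set zs. kap y z)"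
    unfolding sum_distrib_left[symmetric]
  proof (subst kap_partial_fractions)
    show "odd (card (set zs))" using odd True by (simp add: distinct_card)
    show "y + y \<noteq> 0" by (rule nz) simp_all
    show "z + y \<noteq> 0" if "z \<in> set zs" for z by (rule nz) (use that in simp_all)
    show "z + w \<noteq> 0" if "z \<in> set zs" "w \<in> set zs" for z w by (rule nz) (use that in simp_all)
  qed simp_all
  also have "(\<Prod>z\<in>set zs. kap y z) = (\<Prod>z\<leftarrow>zs. kap y z)"
    using True by (rule prod.distinct_set_conv_list)
  finally show ?thesis by (simp add: mult.commute)
next
  case False
  \<comment> \<open>Deleting anything but one of these two copies of w leaves a repetition, so two
    summands remain. Moving w across B costs (-1)^(length B), while the positions differ by length B
    + 1: the two cancel.\<close>
  then obtain A B C w where zs: "zs = A @ [w] @ B @ [w] @ C" using not_distinct_decomp by blast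
  let ?a = "length A" and ?b = "length A + 1 + length B"
  let ?t = "\<lambda>j. (-1) ^ j * kap y (zs ! j) * kap_prod (del_nth j zs)"
  have nd: "\<not> distinct (del_nth j zs)" if j: "j < length zs" "j \<noteq> ?a" "j \<noteq> ?b" for j
  proof -
    have "j < ?a \<or> (?a < j \<and> j < ?b) \<or> ?b < j" using j by linarith
    then show ?thesis
    proof (elim disjE conjE)
      assume "j < ?a"
      then show ?thesis by (auto simp: zs del_nth_def)
    next
      assume "?a < j" "j < ?b"
      then obtain k where "j = ?a + 1 + k" "k < length B" using less_iff_Suc_add by fastforce
      then show ?thesis by (auto simp: zs del_nth_def)
    next
      assume "?b < j"
      then obtain k where "j = ?b + 1 + k" using less_iff_Suc_add by fastforce
      then show ?thesis by (auto simp: zs del_nth_def)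
    qed
  qed
  have "(\<Sum>j<length zs. ?t j) = (\<Sum>j\<in>{?a, ?b}. ?t j)"
  proof (rule sum.mono_neutral_right)
    show "{?a, ?b} \<subseteq> {..<length zs}" by (auto simp: zs)
    show "\<forall>j\<in>{..<length zs} - {?a, ?b}. ?t j = 0" using nd kap_prod_not_distinct by auto
  qed simp
  also have "\<dots> = ?t ?a + ?t ?b" by simp
  also have "\<dots> = 0"
  proof -
    have n: "zs ! ?a = w" "zs ! ?b = w" by (simp_all add: zs nth_append)
    have da: "del_nth ?a zs = (A @ B) @ w # C" and db: "del_nth ?b zs = A @ w # (B @ C)"
      by (simp_all add: zs del_nth_def)
    have "kap_prod (del_nth ?b zs) = (-1) ^ length B * kap_prod (del_nth ?a zs)"
      unfolding da db kap_prod_middle map_append prod_list.append prod_list_kap_swap[of w B]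
      by (simp add: mult_ac)
    then show ?thesis unfolding n by (simp add: power_add mult_ac flip: power_mult_distrib)
  qed
  also have "0 = kap_prod (y # zs)" by (simp add: kap_prod_not_distinct[OF False])
  finally show ?thesis .
qed

subsection \<open>Expansion of the Pfaffian along the first row\<close>

text \<open>The cycle that brings j + 2 to the second place and keeps the order of the other
  entries, a product of j adjacent transpositions.\<close>

definition cyc :: "nat \<Rightarrow> nat \<Rightarrow> nat" where
  "cyc j k = (if k = 2 then j + 2 else if 3 \<le> k \<and> k \<le> j + 2 then k - 1 else k)"

lemma cyc_0: "cyc 0 = id" by (auto simp: cyc_def fun_eq_iff)

lemma cyc_Suc: "cyc (Suc j) = transpose (j + 2) (j + 3) \<circ> cyc j"
  by (auto simp: cyc_def fun_eq_iff transpose_def)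

lemma cyc_permutes: "cyc j permutes {2..j + 2}"
proof (induction j)
  case 0
  show ?case unfolding cyc_0 by (rule permutes_id)
next
  case (Suc j)
  show ?case unfolding cyc_Suc
    by (rule permutes_compose) (rule permutes_subset[OF Suc], simp, rule permutes_swap_id, simp_all)
qed

lemma permutation_cyc: "permutation (cyc j)"
  using cyc_permutes permutation_permutes by blast

lemma sign_cyc: "sign (cyc j) = (-1) ^ j"
proof (induction j)
  case (Suc j)
  have "sign (cyc (Suc j)) = sign (transpose (j + 2) (j + 3)) * sign (cyc j)"
    unfolding cyc_Suc by (rule sign_compose) (simp_all add: permutation_swap_id permutation_cyc)
  then show ?case by (simp add: sign_swap_id Suc)
qed (simp add: cyc_0 sign_id)

lemma cyc_less_iff: "3 \<le> a \<Longrightarrow> 3 \<le> b \<Longrightarrow> cyc j a < cyc j b \<longleftrightarrow> a < b"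
  by (auto simp: cyc_def)

definition shift2 :: "(nat \<Rightarrow> nat) \<Rightarrow> nat \<Rightarrow> nat" where
  "shift2 s k = (if k < 3 then k else s (k - 2) + 2)"

lemma shift2_id: "shift2 id = id" by (auto simp: shift2_def fun_eq_iff)

lemma shift2_swap:
  assumes "1 \<le> a" "1 \<le> b"
  shows "shift2 (transpose a b \<circ> p) = transpose (a + 2) (b + 2) \<circ> shift2 p"
proof
  fix k
  show "shift2 (transpose a b \<circ> p) k = (transpose (a + 2) (b + 2) \<circ> shift2 p) k"
    using assms by (cases "k < 3") (auto simp: shift2_def transpose_def)
qed

text \<open>Each transposition of p shifts to a transposition, so induction over transpositions
  gives support and sign at once.\<close>

lemma shift2_permutes:
  assumes s: "s permutes {1..2*m}"
  shows "shift2 s permutes {3..2 * Suc m}" "sign (shift2 s) = sign s"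
proof -
  have "shift2 s permutes {3..2 * Suc m} \<and> sign (shift2 s) = sign s"
    using s finite_atLeastAtMost
  proof (induction rule: permutes_induct)
    case id
    show ?case by (simp only: shift2_id sign_id permutes_id simp_thms)
  next
    case (swap a b p)
    have P: "permutation p" "permutation (shift2 p)"
      using swap permutation_permutes finite_atLeastAtMost by blast+
    have "sign (transpose (a + 2) (b + 2) \<circ> shift2 p) = sign (transpose a b \<circ> p)"
      using swap P by (simp add: sign_compose permutation_swap_id sign_swap_id)
    moreover have "transpose (a + 2) (b + 2) \<circ> shift2 p permutes {3..2 * Suc m}"
      using swap by (intro permutes_compose permutes_swap_id) auto
    ultimately show ?case using swap(1,2) by (simp only: shift2_swap atLeastAtMost_iff)
  qed
  then show "shift2 s permutes {3..2 * Suc m}" "sign (shift2 s) = sign s" by auto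
qed

text \<open>A matching of \<open>{1..2m+2}\<close> is a choice of partner \<open>j + 2\<close> for \<open>1\<close> together with a matching of
  the remaining elements, relabelled increasingly.\<close>

lemma bij_betw_matchings:
  "bij_betw (\<lambda>(j, s). cyc j \<circ> shift2 s) ({..<2*m+1} \<times> matchings m) (matchings (Suc m))"
proof (rule bij_betwI')
  fix p q assume pq: "p \<in> {..<2*m+1} \<times> matchings m" "q \<in> {..<2*m+1} \<times> matchings m"
  obtain j s k t where p: "p = (j, s)" and q: "q = (k, t)" by force
  have s: "s permutes {1..2*m}" and t: "t permutes {1..2*m}" using pq by (auto simp: p q matchings_def)
  have "j = k \<and> s = t" if eq: "cyc j \<circ> shift2 s = cyc k \<circ> shift2 t"
  proof
    show jk: "j = k" using fun_cong[OF eq, of 2] by (simp add: shift2_def cyc_def)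
    have sh: "shift2 s = shift2 t"
    proof
      fix x show "shift2 s x = shift2 t x"
        using fun_cong[OF eq, of x] permutes_inj[OF cyc_permutes[of j]] jk by (simp add: inj_def)
    qed
    show "s = t"
    proof
      fix x show "s x = t x"
      proof (cases "x = 0")
        case True
        then show ?thesis using permutes_not_in[OF s, of 0] permutes_not_in[OF t, of 0] by simp
      next
        case False
        then show ?thesis using fun_cong[OF sh, of "x + 2"] by (simp add: shift2_def)
      qed
    qed
  qed
  then show "((case p of (j, s) \<Rightarrow> cyc j \<circ> shift2 s) = (case q of (j, s) \<Rightarrow> cyc j \<circ> shift2 s)) = (p = q)"
    by (auto simp: p q)
next
  fix p assume p': "p \<in> {..<2*m+1} \<times> matchings m"
  obtain j s where p: "p = (j, s)" by force
  have j: "j < 2*m+1" and s: "s permutes {1..2*m}" and sm: "s \<in> matchings m"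
    and s1: "\<And>i. i \<in> {1..m} \<Longrightarrow> s (2*i - 1) < s (2*i)"
    and s2: "\<And>i. i \<in> {1..<m} \<Longrightarrow> s (2*i - 1) < s (2*i + 1)"
    using p' by (auto simp: p matchings_def)
  let ?r = "cyc j \<circ> shift2 s"
  have s_pos: "1 \<le> s k" if "1 \<le> k" for k
    using permutes_in_image[OF s, of k] permutes_not_in[OF s, of k] that by (cases "k \<in> {1..2*m}") auto
  have r: "?r (k + 2) = cyc j (s k + 2)" if "1 \<le> k" for k using that by (simp add: shift2_def)
  have r12: "?r 1 = 1" "?r 2 = j + 2" by (simp_all add: shift2_def cyc_def)
  have cyc_ge: "2 \<le> cyc j k" if "3 \<le> k" for k using that by (auto simp: cyc_def)
  have less: "?r (k + 2) < ?r (l + 2)" if "1 \<le> k" "1 \<le> l" "s k < s l" for k l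
    unfolding r[OF that(1)] r[OF that(2)] using that s_pos[of k] s_pos[of l] by (subst cyc_less_iff) auto
  have "?r permutes {1..2 * Suc m}"
    by (rule permutes_compose) (rule permutes_subset[OF shift2_permutes(1)[OF s]], simp,
        rule permutes_subset[OF cyc_permutes], use j in simp)
  moreover have "?r (2*i - 1) < ?r (2*i)" if i: "i \<in> {1..Suc m}" for i
  proof (cases "i = 1")
    case True
    then show ?thesis using r12 by simp
  next
    case False
    then have "i - 1 \<in> {1..m}" using i by auto
    then have "?r (2*(i-1) - 1 + 2) < ?r (2*(i-1) + 2)" by (intro less s1) auto
    moreover have "2*(i-1) - 1 + 2 = 2*i - 1" "2*(i-1) + 2 = 2*i" using False i by auto
    ultimately show ?thesis by metis
  qed
  moreover have "?r (2*i - 1) < ?r (2*i + 1)" if i: "i \<in> {1..<Suc m}" for i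
  proof (cases "i = 1")
    case True
    have "2 \<le> ?r (1 + 2)" unfolding r[OF order_refl] by (rule cyc_ge) (use s_pos[of 1] in simp)
    moreover have "1 + 2 = 2 * i + 1" "2 * i - 1 = 1" using True by auto
    ultimately have "2 \<le> ?r (2 * i + 1)" "?r (2 * i - 1) = 1" using r12(1) by metis+
    then show ?thesis by linarith
  next
    case False
    then have "i - 1 \<in> {1..<m}" using i by auto
    then have "?r (2*(i-1) - 1 + 2) < ?r (2*(i-1) + 1 + 2)" by (intro less s2) auto
    moreover have "2*(i-1) - 1 + 2 = 2*i - 1" "2*(i-1) + 1 + 2 = 2*i + 1" using False i by auto
    ultimately show ?thesis by metis
  qed
  ultimately show "(case p of (j, s) \<Rightarrow> cyc j \<circ> shift2 s) \<in> matchings (Suc m)"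
    unfolding p prod.case matchings_def mem_Collect_eq by blast
next
  fix r assume "r \<in> matchings (Suc m)"
  then have r: "r permutes {1..2 * Suc m}"
    and r1: "\<And>i. i \<in> {1..Suc m} \<Longrightarrow> r (2*i - 1) < r (2*i)"
    and r2: "\<And>i. i \<in> {1..<Suc m} \<Longrightarrow> r (2*i - 1) < r (2*i + 1)"
    by (auto simp: matchings_def)
  \<comment> \<open>The left ends of the pairs increase and each right end exceeds its left end, so
    the least value 1 is attained at position 1.\<close>
  have odd_ge: "r 1 \<le> r (2*i + 1)" if "i \<le> m" for i
    using that
  proof (induction i)
    case (Suc i)
    have "r (2 * Suc i - 1) < r (2 * Suc i + 1)" by (rule r2) (use Suc.prems in auto)
    moreover have "2 * Suc i - 1 = 2 * i + 1" by simp
    ultimately show ?case using Suc by simp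
  qed simp
  have ge: "r 1 \<le> r k" if "k \<in> {1..2 * Suc m}" for k
  proof (cases "odd k")
    case True
    then obtain i where "k = 2*i + 1" by (elim oddE)
    then show ?thesis using odd_ge[of i] that by simp
  next
    case False
    then obtain i where k: "k = 2*i" by (metis evenE)
    then have i: "i \<in> {1..Suc m}" using that by auto
    then have "2*i - 1 = 2*(i-1) + 1" by auto
    then have "r 1 \<le> r (2*i - 1)" using odd_ge[of "i - 1"] i by auto
    then show ?thesis using r1[OF i] k by simp
  qed
  have "1 \<in> r ` {1..2 * Suc m}" using permutes_image[OF r] by simp
  then obtain k where "k \<in> {1..2 * Suc m}" "r k = 1" by (metis imageE)
  then have "r 1 \<le> 1" using ge by metis
  moreover have "r 1 \<in> {1..2 * Suc m}" using permutes_in_image[OF r, of 1] by simp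
  ultimately have r_1: "r 1 = 1" by simp
  have "r 2 \<in> {1..2 * Suc m}" using permutes_in_image[OF r, of 2] by simp
  moreover have "r 1 < r 2" using r1[of 1] by simp
  ultimately obtain j where j: "r 2 = j + 2" "j < 2*m + 1"
    using r_1 le_Suc_ex[of 2 "r 2"] by auto
  \<comment> \<open>Undoing the cycle makes 2 the partner of 1; the order of the remaining values is
    kept by \<open>cyc_less_iff\<close>.\<close>
  define t where "t = inv (cyc j) \<circ> r"
  have rt: "r = cyc j \<circ> t"
    unfolding t_def comp_assoc[symmetric] permutes_inv_o(1)[OF cyc_permutes] by simp
  have "inv (cyc j) permutes {1..2 * Suc m}"
    by (rule permutes_inv, rule permutes_subset[OF cyc_permutes]) (use j in simp)
  then have t: "t permutes {1..2 * Suc m}" unfolding t_def by (intro permutes_compose r)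
  have "cyc j (t 1) = cyc j 1" "cyc j (t 2) = cyc j 2"
    using r_1 j unfolding rt by (simp_all add: cyc_def)
  then have t12: "t 1 = 1" "t 2 = 2"
    using permutes_inj[OF cyc_permutes[of j]] unfolding inj_def by blast+
  have t3: "t permutes {3..2 * Suc m}"
  proof (rule permutes_superset[OF t])
    fix x assume "x \<in> {1..2 * Suc m} - {3..2 * Suc m}"
    then have "x = 1 \<or> x = 2" by auto
    then show "t x = x" using t12 by auto
  qed
  have t_ge: "3 \<le> t k" if "3 \<le> k" for k
    using permutes_in_image[OF t3, of k] permutes_not_in[OF t3, of k] that
    by (cases "k \<in> {3..2 * Suc m}") auto
  define s where "s k = (if k = 0 then 0 else t (k + 2) - 2)" for k
  have ts: "t (k + 2) = s k + 2" if "1 \<le> k" for k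
    using t_ge[of "k + 2"] that by (simp add: s_def)
  have sh: "shift2 s = t"
  proof
    fix k
    show "shift2 s k = t k"
    proof (cases "k < 3")
      case True
      then show ?thesis using permutes_not_in[OF t3, of k] by (simp add: shift2_def)
    next
      case False
      then have "t (k - 2 + 2) = s (k - 2) + 2" by (intro ts) simp
      moreover have "k - 2 + 2 = k" using False by simp
      ultimately show ?thesis using False by (simp add: shift2_def)
    qed
  qed
  have s: "s permutes {1..2*m}"
  proof (rule bij_imp_permutes)
    have 1: "bij_betw (\<lambda>k. k + 2) {1..2*m} {3..2 * Suc m}"
      by (rule bij_betw_byWitness[where f'="\<lambda>k. k - 2"]) auto
    have 2: "bij_betw (\<lambda>k. k - 2) {3..2 * Suc m} {1..2*m}"
      by (rule bij_betw_byWitness[where f'="\<lambda>k. k + 2"]) auto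
    have "bij_betw ((\<lambda>k. k - 2) \<circ> (t \<circ> (\<lambda>k. k + 2))) {1..2*m} {1..2*m}"
      by (intro bij_betw_trans[OF _ 2] bij_betw_trans[OF 1] permutes_imp_bij t3)
    then show "bij_betw s {1..2*m} {1..2*m}"
      by (rule bij_betw_cong[THEN iffD1, rotated]) (auto simp: s_def)
    fix x assume x: "x \<notin> {1..2*m}"
    then have "x = 0 \<or> x + 2 \<notin> {3..2 * Suc m}" by auto
    then show "s x = x" using permutes_not_in[OF t3, of "x + 2"] by (auto simp: s_def)
  qed
  have less: "s k < s l" if "1 \<le> k" "1 \<le> l" "r (k + 2) < r (l + 2)" for k l
  proof -
    have "cyc j (s k + 2) < cyc j (s l + 2)" using that ts by (simp add: rt)
    moreover have "3 \<le> s k + 2" "3 \<le> s l + 2" using ts t_ge[of "k + 2"] t_ge[of "l + 2"] that by auto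
    ultimately show ?thesis using cyc_less_iff by simp
  qed
  have "s \<in> matchings m"
    unfolding matchings_def mem_Collect_eq
  proof (intro conjI ballI s)
    fix i assume i: "i \<in> {1..m}"
    have "r (2 * Suc i - 1) < r (2 * Suc i)" by (rule r1) (use i in auto)
    moreover have "2 * Suc i - 1 = 2*i - 1 + 2" "2 * Suc i = 2*i + 2" using i by auto
    ultimately have "r (2*i - 1 + 2) < r (2*i + 2)" by metis
    then show "s (2*i - 1) < s (2*i)" by (rule less[rotated 2]) (use i in auto)
  next
    fix i assume i: "i \<in> {1..<m}"
    have "r (2 * Suc i - 1) < r (2 * Suc i + 1)" by (rule r2) (use i in auto)
    moreover have "2 * Suc i - 1 = 2*i - 1 + 2" "2 * Suc i + 1 = 2*i + 1 + 2" using i by auto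
    ultimately have "r (2*i - 1 + 2) < r (2*i + 1 + 2)" by metis
    then show "s (2*i - 1) < s (2*i + 1)" by (rule less[rotated 2]) (use i in auto)
  qed
  then show "\<exists>p\<in>{..<2*m+1} \<times> matchings m. r = (case p of (j, s) \<Rightarrow> cyc j \<circ> shift2 s)"
    using j sh rt by (intro bexI[of _ "(j, s)"]) auto
qed

text \<open>On arguments from 1 on, the increasing enumeration of the positive numbers other than 1
  and j + 2.\<close>

definition skip :: "nat \<Rightarrow> nat \<Rightarrow> nat" where "skip j a = (if a \<le> j then a + 1 else a + 2)"

text \<open>With j counted from 0, the partner of 1 is j + 2 and the sign is that of
  \<open>cyc j\<close>.\<close>

lemma pfaffian_Suc:
  "pfaffian (Suc m) M = (\<Sum>j<2*m+1. (-1) ^ j * M 1 (j + 2) * pfaffian m (\<lambda>a b. M (skip j a) (skip j b)))"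
proof -
  let ?t = "\<lambda>s. of_int (sign s) * (\<Prod>i\<in>{1..Suc m}. M (s (2*i - 1)) (s (2*i)))"
  have "pfaffian (Suc m) M = (\<Sum>p\<in>{..<2*m+1} \<times> matchings m. ?t (case p of (j, s) \<Rightarrow> cyc j \<circ> shift2 s))"
    unfolding pfaffian_alt by (rule sum.reindex_bij_betw[OF bij_betw_matchings, symmetric])
  also have "\<dots> = (\<Sum>j<2*m+1. \<Sum>s\<in>matchings m. ?t (cyc j \<circ> shift2 s))"
    by (simp add: sum.cartesian_product case_prod_beta)
  also have "\<dots> = (\<Sum>j<2*m+1. \<Sum>s\<in>matchings m. (-1) ^ j * M 1 (j + 2) *
      (of_int (sign s) * (\<Prod>i\<in>{1..m}. M (skip j (s (2*i - 1))) (skip j (s (2*i))))))"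
  proof (intro sum.cong refl)
    fix j s assume sm: "s \<in> matchings m"
    then have s: "s permutes {1..2*m}" by (simp add: matchings_def)
    have "permutation (shift2 s)"
      using shift2_permutes(1)[OF s] permutation_permutes finite_atLeastAtMost by blast
    then have sgn: "sign (cyc j \<circ> shift2 s) = (-1) ^ j * sign s"
      by (simp add: sign_compose permutation_cyc sign_cyc shift2_permutes(2)[OF s])
    let ?r = "cyc j \<circ> shift2 s"
    have pr: "(\<Prod>i\<in>{1..Suc m}. M (?r (2*i - 1)) (?r (2*i)))
      = M (?r 1) (?r 2) * (\<Prod>i\<in>{1..m}. M (?r (2*i - 1 + 2)) (?r (2*i + 2)))"
    proof -
      have "(\<Prod>i\<in>{1..Suc m}. M (?r (2*i - 1)) (?r (2*i)))
        = M (?r 1) (?r 2) * (\<Prod>i\<in>{Suc 1..Suc m}. M (?r (2*i - 1)) (?r (2*i)))"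
        by (subst prod.atLeast_Suc_atMost) simp_all
      also have "(\<Prod>i\<in>{Suc 1..Suc m}. M (?r (2*i - 1)) (?r (2*i)))
        = (\<Prod>i\<in>{1..m}. M (?r (2 * Suc i - 1)) (?r (2 * Suc i)))"
        by (rule prod.shift_bounds_cl_Suc_ivl)
      also have "\<dots> = (\<Prod>i\<in>{1..m}. M (?r (2*i - 1 + 2)) (?r (2*i + 2)))"
      proof (rule prod.cong[OF refl])
        fix i assume "i \<in> {1..m}"
        then have "2 * Suc i - 1 = 2*i - 1 + 2" "2 * Suc i = 2*i + 2" by auto
        then show "M (?r (2 * Suc i - 1)) (?r (2 * Suc i)) = M (?r (2*i - 1 + 2)) (?r (2*i + 2))" by metis
      qed
      finally show ?thesis .
    qed
    have rk: "?r (k + 2) = skip j (s k)" if "k \<in> {1..2*m}" for k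
    proof -
      have "s k \<in> {1..2*m}" using permutes_in_image[OF s, of k] that by simp
      then show ?thesis using that by (auto simp: shift2_def skip_def cyc_def)
    qed
    have "(\<Prod>i\<in>{1..m}. M (?r (2*i - 1 + 2)) (?r (2*i + 2)))
      = (\<Prod>i\<in>{1..m}. M (skip j (s (2*i - 1))) (skip j (s (2*i))))"
    proof (rule prod.cong[OF refl])
      fix i assume "i \<in> {1..m}"
      then have "2*i - 1 \<in> {1..2*m}" "2*i \<in> {1..2*m}" by auto
      from this[THEN rk] show "M (?r (2*i - 1 + 2)) (?r (2*i + 2)) = M (skip j (s (2*i - 1))) (skip j (s (2*i)))"
        by (simp only:)
    qed
    moreover have "?r 1 = 1" "?r 2 = j + 2" by (simp_all add: shift2_def cyc_def)
    ultimately show "?t ?r = (-1) ^ j * M 1 (j + 2) *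
      (of_int (sign s) * (\<Prod>i\<in>{1..m}. M (skip j (s (2*i - 1))) (skip j (s (2*i)))))"
      unfolding pr sgn by (simp only: of_int_mult of_int_power of_int_minus of_int_1 mult_ac)
  qed
  finally show ?thesis unfolding pfaffian_alt sum_distrib_left .
qed

subsection \<open>The sum over coset representatives\<close>

text \<open>Both sides obey the same recursion, \<open>pfaffian_Suc\<close> and
  \<open>kap_prod_expand\<close>: removing rows and columns 1 and j + 2 of the matrix amounts to
  deleting entry j of the tail.\<close>

lemma pfaffian_kap:
  fixes zs :: "'a::field list"
  assumes "length zs = 2 * m" "\<And>u v. u \<in> set zs \<Longrightarrow> v \<in> set zs \<Longrightarrow> u + v \<noteq> 0"
  shows "pfaffian m (\<lambda>a b. kap (zs ! (a - 1)) (zs ! (b - 1))) = kap_prod zs"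
  using assms
proof (induction m arbitrary: zs)
  case 0
  have "{p. p permutes {1..2 * 0::nat}} = {id}" by (simp add: permutes_empty)
  then have "matchings 0 = {id}" unfolding matchings_def by auto
  then show ?case using 0 by (simp add: pfaffian_alt)
next
  case (Suc m)
  then obtain y ws where zs: "zs = y # ws" by (cases zs) auto
  have len: "length ws = 2 * m + 1" using Suc.prems(1) zs by simp
  have nz: "\<And>u v. u \<in> set (y # ws) \<Longrightarrow> v \<in> set (y # ws) \<Longrightarrow> u + v \<noteq> 0"
    using Suc.prems(2) unfolding zs .
  have "pfaffian (Suc m) (\<lambda>a b. kap (zs ! (a - 1)) (zs ! (b - 1)))
    = (\<Sum>j<2*m+1. (-1) ^ j * kap y (ws ! j) * kap_prod (del_nth j ws))"
    unfolding pfaffian_Suc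
  proof (intro sum.cong refl arg_cong2[where f="(*)"])
    fix j assume j: "j \<in> {..<2*m+1}"
    show "kap (zs ! (1 - 1)) (zs ! (j + 2 - 1)) = kap y (ws ! j)" by (simp add: zs)
    have nth: "zs ! (skip j a - 1) = del_nth j ws ! (a - 1)" if a1: "1 \<le> a" "a \<le> 2 * m" for a
    proof -
      obtain c where a: "a = Suc c" using a1 not0_implies_Suc[of a] by auto
      show ?thesis using a1 j len
        by (auto simp: a zs skip_def del_nth_def nth_append min_def)
    qed
    have "pfaffian m (\<lambda>a b. kap (zs ! (skip j a - 1)) (zs ! (skip j b - 1)))
      = pfaffian m (\<lambda>a b. kap (del_nth j ws ! (a - 1)) (del_nth j ws ! (b - 1)))"
      by (rule pfaffian_cong) (simp add: nth del: One_nat_def)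
    also have "\<dots> = kap_prod (del_nth j ws)"
    proof (rule Suc.IH)
      show "length (del_nth j ws) = 2 * m" using j len by (simp add: del_nth_def)
      have sub: "set (del_nth j ws) \<subseteq> set (y # ws)"
        unfolding del_nth_def using set_take_subset set_drop_subset by fastforce
      then show "u + v \<noteq> 0" if "u \<in> set (del_nth j ws)" "v \<in> set (del_nth j ws)" for u v
        using nz that by blast
    qed
    finally show "pfaffian m (\<lambda>a b. kap (zs ! (skip j a - 1)) (zs ! (skip j b - 1))) = kap_prod (del_nth j ws)" .
  qed
  also have "\<dots> = kap_prod zs"
    unfolding zs using kap_prod_expand[of ws y, OF _ nz] len by simp
  finally show ?case .
qed

lemma kap_prod_map: "kap_prod (map g [a..<b]) = (\<Prod>i\<in>{a..<b}. \<Prod>j\<in>{i+1..<b}. kap (g i) (g j))"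
proof (induction "b - a" arbitrary: a)
  case (Suc k)
  then have ab: "a < b" by simp
  have "kap_prod (map g [Suc a..<b]) = (\<Prod>i\<in>{Suc a..<b}. \<Prod>j\<in>{i+1..<b}. kap (g i) (g j))"
    by (rule Suc.hyps) (use Suc.hyps(2) in simp)
  moreover have "(\<Prod>w\<leftarrow>map g [Suc a..<b]. kap (g a) w) = (\<Prod>j\<in>{a+1..<b}. kap (g a) (g j))"
    using prod.distinct_set_conv_list[of "[Suc a..<b]" "\<lambda>j. kap (g a) (g j)"] by (simp add: comp_def)
  ultimately show ?case using ab
    by (simp add: upt_conv_Cons prod.atLeast_Suc_lessThan[of a b])
qed simp

lemma pfaffian_kap_fun:
  fixes z :: "nat \<Rightarrow> 'a::field"
  assumes "\<And>i j. z i + z j \<noteq> 0"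
  shows "pfaffian m (\<lambda>i j. kap (z i) (z j)) = (\<Prod>i\<in>{1..2*m}. \<Prod>j\<in>{i+1..2*m}. kap (z i) (z j))"
proof -
  let ?zs = "map z [1..<2*m+1]"
  have "pfaffian m (\<lambda>i j. kap (z i) (z j)) = pfaffian m (\<lambda>a b. kap (?zs ! (a - 1)) (?zs ! (b - 1)))"
    by (rule pfaffian_cong) (simp add: nth_append del: upt_Suc)
  also have "\<dots> = kap_prod ?zs"
    by (rule pfaffian_kap) (use assms in auto)
  also have "\<dots> = (\<Prod>i\<in>{1..<2*m+1}. \<Prod>j\<in>{i+1..<2*m+1}. kap (z i) (z j))" by (rule kap_prod_map)
  finally show ?thesis by (simp only: Suc_eq_plus1[symmetric] atLeastLessThanSuc_atLeastAtMost)
qed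

text \<open>The substitution \<open>z = x / (2 + \<beta>x)\<close> turns the multiplicative formal group law into the
  additive one as far as \<open>(y - x) / (y \<oplus> x)\<close> is concerned.\<close>

lemma Kcoef_kap:
  defines "z \<equiv> \<lambda>a. emb (xv a) / (2 + emb beta * emb (xv a))"
  shows "Kcoef a b = kap (z a) (z b)" "z a + z b \<noteq> 0"
proof -
  let ?B = "emb beta" and ?x = "emb (xv a)" and ?y = "emb (xv b)"
  have two: "emb 2 = 2" using emb_of_int[of 2] by simp
  have nz: "2 + ?B * ?x \<noteq> 0" "2 + ?B * ?y \<noteq> 0"
    using one_plus_beta_nz(2) emb_eq_0_iff by (metis emb_simps(1,3) two)+
  have p: "fgl_plus ?B ?y ?x \<noteq> 0"
    unfolding emb_fgl_plus[symmetric] emb_eq_0_iff by (rule fgl_plus_nz)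
  have t0: "(2::rat_fun) \<noteq> 0" using two emb_eq_0_iff[of 2] by (simp add: fps_eq_iff numeral_fps_const)
  let ?d = "(2 + ?B * ?x) * (2 + ?B * ?y)"
  have d: "?d \<noteq> 0" using nz by simp
  \<comment> \<open>The mixed terms decide: y (2 + beta x) - x (2 + beta y) = 2 (y - x), whereas the
    sum is 2 (x + y + beta x y). The common 2/d drops out of the ratio.\<close>
  have minus: "z b - z a = 2 * (?y - ?x) / ?d" unfolding z_def using nz
    by (simp add: diff_frac_eq) (simp add: algebra_simps)
  have plus: "z b + z a = 2 * fgl_plus ?B ?y ?x / ?d" unfolding z_def using nz
    by (simp add: add_frac_eq fgl_plus_def) (simp add: algebra_simps)
  have cancel: "u / v = (2 * u / w) / (2 * v / w)" if "w \<noteq> 0" for u v w :: rat_fun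
    using that t0 by simp
  show "Kcoef a b = kap (z a) (z b)"
    unfolding kap_def Kcoef_def minus plus by (rule cancel[OF d])
  have "z b + z a \<noteq> 0" unfolding plus using d t0 p by simp
  then show "z a + z b \<noteq> 0" by (simp add: add.commute)
qed

lemma pfaffian_Kcoef:
  "pfaffian m (\<lambda>i j. Kcoef (f i) (f j)) = (\<Prod>i\<in>{1..2*m}. \<Prod>j\<in>{i+1..2*m}. Kcoef (f i) (f j))"
  unfolding Kcoef_kap(1) by (rule pfaffian_kap_fun) (rule Kcoef_kap(2))

section \<open>From products of residues to the summands of GQ\<close>

definition hcoef :: "nat \<Rightarrow> nat \<Rightarrow> rat_fun" where
  "hcoef a b = fgl_plus (emb beta) (emb (xv a)) (emb (xv b)) / fgl_minus (emb beta) (emb (xv a)) (emb (xv b))"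

definition dcoef :: "nat \<Rightarrow> nat \<Rightarrow> rat_fun" where
  "dcoef p a = fgl_plus (emb beta) (emb (xv a)) (emb (xv a)) * (\<Prod>k=1..p. fgl_plus (emb beta) (emb (xv a)) (emb (bv k)))"

text \<open>Each 1 + beta x_j turns x_a - x_j into x_a (-) x_j. The factors with j = a have no
  partner in the denominator and stay behind as 1 + beta x_a and as the x_a (+) x_a of GQ.\<close>

lemma Acoef_alt:
  assumes "a \<in> {1..n}"
  shows "Acoef n p a = (1 + emb beta * emb (xv a)) * dcoef p a * (\<Prod>j\<in>{1..n}-{a}. hcoef a j)"
proof -
  have "hcoef a j = (1 + emb beta * emb (xv j)) * fgl_plus (emb beta) (emb (xv a)) (emb (xv j))
      / (emb (xv a) - emb (xv j))" for j
    by (simp add: hcoef_def fgl_minus_def)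
  then show ?thesis
    unfolding Acoef_def dcoef_def prod.remove[OF finite_atLeastAtMost assms]
    by (simp add: prod.distrib prod_dividef mult_ac)
qed

text \<open>K is the reciprocal of the ratio in the order b, a, except that x_b (-) x_a = (x_b -
  x_a)/(1 + beta x_a) has a denominator.\<close>

lemma hcoef_Kcoef: "a \<noteq> b \<Longrightarrow> hcoef b a * Kcoef a b = 1 + emb beta * emb (xv a)"
proof -
  assume ab: "a \<noteq> b"
  have "emb (xv b) - emb (xv a) \<noteq> 0"
    using xv_diff_nz[of b a] ab emb_eq_0_iff emb_simps(2) by metis
  moreover have "fgl_plus (emb beta) (emb (xv b)) (emb (xv a)) \<noteq> 0"
    unfolding emb_fgl_plus[symmetric] emb_eq_0_iff by (rule fgl_plus_nz)
  ultimately show ?thesis by (simp add: hcoef_def Kcoef_def fgl_minus_def)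
qed

lemma prod_offdiagonal:
  fixes r :: nat
  shows "(\<Prod>t\<in>{1..r}. \<Prod>s\<in>{1..r}-{t}. g t s) = (\<Prod>i\<in>{1..r}. \<Prod>j\<in>{i+1..r}. g i j * (g j i :: 'a::comm_monoid_mult))"
proof (induction r)
  case (Suc r)
  have "(\<Prod>s\<in>{1..Suc r}-{t}. g t s) = (\<Prod>s\<in>{1..r}-{t}. g t s) * g t (Suc r)" if "t \<in> {1..r}" for t
  proof -
    have "{1..Suc r}-{t} = insert (Suc r) ({1..r}-{t})" using that by auto
    then show ?thesis by (simp add: mult.commute)
  qed
  moreover have "{1..Suc r} - {Suc r} = {1..r}" by auto
  ultimately have "(\<Prod>t\<in>{1..Suc r}. \<Prod>s\<in>{1..Suc r}-{t}. g t s)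
     = (\<Prod>t\<in>{1..r}. \<Prod>s\<in>{1..r}-{t}. g t s) * (\<Prod>t\<in>{1..r}. g t (Suc r)) * (\<Prod>s\<in>{1..r}. g (Suc r) s)"
    by (simp add: prod.distrib)
  moreover have "(\<Prod>j\<in>{i+1..Suc r}. g i j * g j i) = (\<Prod>j\<in>{i+1..r}. g i j * g j i) * (g i (Suc r) * g (Suc r) i)"
    if "i \<in> {1..r}" for i using that by simp
  then have "(\<Prod>i\<in>{1..Suc r}. \<Prod>j\<in>{i+1..Suc r}. g i j * g j i)
     = (\<Prod>i\<in>{1..r}. \<Prod>j\<in>{i+1..r}. g i j * g j i) * ((\<Prod>t\<in>{1..r}. g t (Suc r)) * (\<Prod>s\<in>{1..r}. g (Suc r) s))"
    by (simp add: prod.distrib mult_ac)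
  ultimately show ?case unfolding Suc by (simp add: mult.assoc)
qed simp

text \<open>The variables not chosen by f enter only through their set. A summand of GQ thus depends
  on w only through its values on {1..r}, that is, on the coset of w.\<close>

definition orbit_term :: "nat \<Rightarrow> nat \<Rightarrow> (nat \<Rightarrow> nat) \<Rightarrow> (nat \<Rightarrow> nat) \<Rightarrow> rat_fun" where
  "orbit_term n r nu f = (\<Prod>i\<in>{1..r}. dcoef (nu i - 1) (f i)) *
     ((\<Prod>i\<in>{1..r}. \<Prod>j\<in>{i+1..r}. hcoef (f i) (f j)) *
      (\<Prod>i\<in>{1..r}. \<Prod>c\<in>{1..n} - f ` {1..r}. hcoef (f i) c))"

text \<open>The P supply the ratios of x_(f i) and x_(f j) in both orders. For i < j, K cancels the
  order j, i and leaves 1 + beta x_(f i); over all j this is the power r - i, and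
  \<open>Acoef_alt\<close> adds one. The total r + 1 - i is the exponent of \<open>W\<close> in
  \<open>Pcoef\<close>.\<close>

lemma prod_Pcoef_Kcoef:
  fixes m :: nat
  defines "r \<equiv> 2 * m"
  assumes f: "f \<in> {1..r} \<rightarrow> {1..n}" "inj_on f {1..r}"
  shows "(\<Prod>t\<in>{1..r}. Pcoef n m nu t (f t)) * (\<Prod>i\<in>{1..r}. \<Prod>j\<in>{i+1..r}. Kcoef (f i) (f j))
    = orbit_term n r nu f"
proof -
  let ?b = "\<lambda>a. 1 + emb beta * emb (xv a)" and ?w = "\<lambda>a. emb (W (xv a))"
  let ?R = "{1..n} - f ` {1..r}"
  have bw: "?b a * ?w a = 1" for a
    using arg_cong[OF W_eq[of "xv a"], of emb] by (simp add: emb_simps mult.commute)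
  have P: "Pcoef n m nu t (f t) = dcoef (nu t - 1) (f t) * (\<Prod>s\<in>{1..r}-{t}. hcoef (f t) (f s))
      * (\<Prod>c\<in>?R. hcoef (f t) c) * (?b (f t) * ?w (f t) ^ (r + 1 - t))" if t: "t \<in> {1..r}" for t
  proof -
    have ft: "f t \<in> {1..n}" using f t by auto
    have im: "f ` {1..r} - {f t} = f ` ({1..r} - {t})"
      using inj_on_image_set_diff[OF f(2), of "{1..r}" "{t}"] t by auto
    have sub: "f ` {1..r} \<subseteq> {1..n}" using f(1) by auto
    have mem: "f t \<in> f ` {1..r}" using t by (rule imageI)
    have "A - {x} = (S - {x}) \<union> (A - S)" "(S - {x}) \<inter> (A - S) = {}"
      if "S \<subseteq> A" "x \<in> S" for S A :: "nat set" and x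
      using that by auto
    from this[OF sub mem]
    have "(\<Prod>j\<in>{1..n}-{f t}. hcoef (f t) j)
        = (\<Prod>j\<in>f ` {1..r} - {f t}. hcoef (f t) j) * (\<Prod>c\<in>?R. hcoef (f t) c)"
      by (simp only: prod.union_disjoint finite_Diff finite_imageI finite_atLeastAtMost)
    also have "(\<Prod>j\<in>f ` {1..r} - {f t}. hcoef (f t) j) = (\<Prod>s\<in>{1..r}-{t}. hcoef (f t) (f s))"
      unfolding im by (subst prod.reindex[OF inj_on_subset[OF f(2)]]) simp_all
    finally have h: "(\<Prod>j\<in>{1..n}-{f t}. hcoef (f t) j)
        = (\<Prod>s\<in>{1..r}-{t}. hcoef (f t) (f s)) * (\<Prod>c\<in>?R. hcoef (f t) c)" .
    show ?thesis unfolding Pcoef_def Acoef_alt[OF ft] h r_def[symmetric] by (simp only: mult_ac)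
  qed
  have "(\<Prod>i\<in>{1..r}. \<Prod>j\<in>{i+1..r}. hcoef (f i) (f j) * hcoef (f j) (f i)) * (\<Prod>i\<in>{1..r}. \<Prod>j\<in>{i+1..r}. Kcoef (f i) (f j))
     = (\<Prod>i\<in>{1..r}. \<Prod>j\<in>{i+1..r}. hcoef (f i) (f j) * (hcoef (f j) (f i) * Kcoef (f i) (f j)))"
    by (simp only: prod.distrib mult.assoc)
  also have "\<dots> = (\<Prod>i\<in>{1..r}. \<Prod>j\<in>{i+1..r}. hcoef (f i) (f j) * ?b (f i))"
  proof (intro prod.cong refl)
    fix i j assume "i \<in> {1..r}" "j \<in> {i+1..r}"
    then have "i \<in> {1..r}" "j \<in> {1..r}" "i \<noteq> j" by auto
    then have ne: "f i \<noteq> f j" using inj_on_eq_iff[OF f(2)] by blast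
    show "hcoef (f i) (f j) * (hcoef (f j) (f i) * Kcoef (f i) (f j)) = hcoef (f i) (f j) * ?b (f i)"
      unfolding hcoef_Kcoef[OF ne] ..
  qed
  also have "\<dots> = (\<Prod>i\<in>{1..r}. \<Prod>j\<in>{i+1..r}. hcoef (f i) (f j)) * (\<Prod>i\<in>{1..r}. ?b (f i) ^ (r - i))"
  proof -
    have "(\<Prod>j\<in>{i+1..r}. ?b (f i)) = ?b (f i) ^ (r - i)" for i by simp
    then show ?thesis by (simp only: prod.distrib)
  qed
  finally have K: "(\<Prod>i\<in>{1..r}. \<Prod>j\<in>{i+1..r}. hcoef (f i) (f j) * hcoef (f j) (f i)) * (\<Prod>i\<in>{1..r}. \<Prod>j\<in>{i+1..r}. Kcoef (f i) (f j))
     = (\<Prod>i\<in>{1..r}. \<Prod>j\<in>{i+1..r}. hcoef (f i) (f j)) * (\<Prod>i\<in>{1..r}. ?b (f i) ^ (r - i))" .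
  have b: "(\<Prod>i\<in>{1..r}. ?b (f i) ^ (r - i)) * (\<Prod>i\<in>{1..r}. ?b (f i) * ?w (f i) ^ (r + 1 - i)) = 1"
    unfolding prod.distrib[symmetric]
  proof (rule prod.neutral, rule ballI)
    fix i assume "i \<in> {1..r}"
    then have "r + 1 - i = Suc (r - i)" by auto
    then have "?b (f i) ^ (r - i) * (?b (f i) * ?w (f i) ^ (r + 1 - i)) = (?b (f i) * ?w (f i)) ^ Suc (r - i)"
      by (simp only: power_mult_distrib power_Suc mult_ac)
    then show "?b (f i) ^ (r - i) * (?b (f i) * ?w (f i) ^ (r + 1 - i)) = 1" by (simp only: bw power_one)
  qed
  have "(\<Prod>t\<in>{1..r}. Pcoef n m nu t (f t)) = (\<Prod>t\<in>{1..r}. dcoef (nu t - 1) (f t)) *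
      (\<Prod>i\<in>{1..r}. \<Prod>j\<in>{i+1..r}. hcoef (f i) (f j) * hcoef (f j) (f i)) *
      (\<Prod>t\<in>{1..r}. \<Prod>c\<in>?R. hcoef (f t) c) * (\<Prod>i\<in>{1..r}. ?b (f i) * ?w (f i) ^ (r + 1 - i))"
    unfolding prod_offdiagonal[symmetric, of "\<lambda>i j. hcoef (f i) (f j)"] prod.distrib[symmetric]
    using P by (intro prod.cong refl) (simp only:)
  then have "(\<Prod>t\<in>{1..r}. Pcoef n m nu t (f t)) * (\<Prod>i\<in>{1..r}. \<Prod>j\<in>{i+1..r}. Kcoef (f i) (f j))
    = (\<Prod>t\<in>{1..r}. dcoef (nu t - 1) (f t)) *
      ((\<Prod>i\<in>{1..r}. \<Prod>j\<in>{i+1..r}. hcoef (f i) (f j) * hcoef (f j) (f i)) * (\<Prod>i\<in>{1..r}. \<Prod>j\<in>{i+1..r}. Kcoef (f i) (f j))) *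
      (\<Prod>t\<in>{1..r}. \<Prod>c\<in>?R. hcoef (f t) c) * (\<Prod>i\<in>{1..r}. ?b (f i) * ?w (f i) ^ (r + 1 - i))"
    by (simp only: mult_ac)
  also have "\<dots> = orbit_term n r nu f *
      ((\<Prod>i\<in>{1..r}. ?b (f i) ^ (r - i)) * (\<Prod>i\<in>{1..r}. ?b (f i) * ?w (f i) ^ (r + 1 - i)))"
    unfolding K orbit_term_def by (simp only: mult_ac)
  finally show ?thesis unfolding b by simp
qed

lemma prod_Kcoef_not_inj:
  fixes r :: nat
  assumes "\<not> inj_on f {1..r}"
  shows "(\<Prod>i\<in>{1..r}. \<Prod>j\<in>{i+1..r}. Kcoef (f i) (f j)) = 0"
proof -
  obtain i j where ij: "i \<in> {1..r}" "j \<in> {1..r}" "i < j" "f i = f j"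
  proof -
    obtain x y where xy: "x \<in> {1..r}" "y \<in> {1..r}" "f x = f y" and "x \<noteq> y"
      using assms unfolding inj_on_def by blast
    then consider "x < y" | "y < x" by linarith
    then show thesis using that xy by cases simp_all
  qed
  have "Kcoef (f i) (f j) = 0" by (simp add: ij(4) Kcoef_def)
  moreover have "j \<in> {i+1..r}" using ij by simp
  ultimately have "\<exists>j\<in>{i+1..r}. Kcoef (f i) (f j) = 0" by blast
  from prod_zero[OF finite_atLeastAtMost this]
  have "\<exists>i\<in>{1..r}. (\<Prod>j\<in>{i+1..r}. Kcoef (f i) (f j)) = 0" using ij(1) by blast
  from prod_zero[OF finite_atLeastAtMost this] show ?thesis .
qed

definition coset_reps :: "nat \<Rightarrow> nat \<Rightarrow> (nat \<Rightarrow> nat) set" where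
  "coset_reps n r = {w. w permutes {1..n} \<and> (\<forall>i j. r < i \<longrightarrow> i < j \<longrightarrow> j \<le> n \<longrightarrow> w i < w j)}"

lemma coset_reps_image:
  assumes "w \<in> coset_reps n r" "r \<le> n"
  shows "w ` {r+1..n} = {1..n} - w ` {1..r}"
proof -
  have w: "w permutes {1..n}" using assms by (simp add: coset_reps_def)
  have "{1..n} = {1..r} \<union> {r+1..n}" using assms(2) by auto
  then have "{1..n} = w ` {1..r} \<union> w ` {r+1..n}" using permutes_image[OF w] by (metis image_Un)
  moreover have "w ` {1..r} \<inter> w ` {r+1..n} = {}"
    by (auto dest!: injD[OF permutes_inj[OF w]])
  ultimately show ?thesis by blast
qed

lemma GQ_orbit:
  assumes "r \<le> n"
  shows "GQ n r nu = (\<Sum>w\<in>coset_reps n r. orbit_term n r nu (restrict w {1..r}))"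
  unfolding GQ_def Let_def coset_reps_def[symmetric]
proof (intro sum.cong refl)
  fix w assume w: "w \<in> coset_reps n r"
  then have p: "w permutes {1..n}" by (simp add: coset_reps_def)
  have "(\<Prod>i=1..r. \<Prod>j=i+1..n. hcoef (w i) (w j))
     = (\<Prod>i=1..r. (\<Prod>j=i+1..r. hcoef (w i) (w j)) * (\<Prod>c\<in>{1..n} - w ` {1..r}. hcoef (w i) c))"
  proof (rule prod.cong[OF refl])
    fix i assume i: "i \<in> {1..r}"
    then have "{i+1..n} = {i+1..r} \<union> {r+1..n}" using assms by auto
    then have "(\<Prod>j=i+1..n. hcoef (w i) (w j)) = (\<Prod>j=i+1..r. hcoef (w i) (w j)) * (\<Prod>j=r+1..n. hcoef (w i) (w j))"
      by (simp only: prod.union_disjoint[OF finite_atLeastAtMost finite_atLeastAtMost] ivl_disj_int_two)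
         (subst prod.union_disjoint, auto)
    also have "(\<Prod>j=r+1..n. hcoef (w i) (w j)) = (\<Prod>c\<in>w ` {r+1..n}. hcoef (w i) c)"
      by (subst prod.reindex) (auto intro: permutes_inj_on[OF p])
    finally show "(\<Prod>j=i+1..n. hcoef (w i) (w j)) = (\<Prod>j=i+1..r. hcoef (w i) (w j)) * (\<Prod>c\<in>{1..n} - w ` {1..r}. hcoef (w i) c)"
      unfolding coset_reps_image[OF w assms] .
  qed
  moreover have "restrict w {1..r} ` {1..r} = w ` {1..r}" by auto
  ultimately show "(\<Prod>i=1..r. fgl_plus (emb beta) (emb (xv (w i))) (emb (xv (w i))) *
       (\<Prod>k=1..nu i - 1. fgl_plus (emb beta) (emb (xv (w i))) (emb (bv k)))) *
     (\<Prod>i=1..r. \<Prod>j=i+1..n. fgl_plus (emb beta) (emb (xv (w i))) (emb (xv (w j))) /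
        fgl_minus (emb beta) (emb (xv (w i))) (emb (xv (w j)))) = orbit_term n r nu (restrict w {1..r})"
    unfolding orbit_term_def hcoef_def[symmetric] dcoef_def[symmetric]
    by (simp add: prod.distrib)
qed

text \<open>As w increases on {r+1..n}, it is determined there by its image, the complement of
  w({1..r}). Conversely, listing that complement in increasing order extends every injective
  f.\<close>

lemma bij_betw_coset_reps:
  assumes "r \<le> n"
  shows "bij_betw (\<lambda>w. restrict w {1..r}) (coset_reps n r) {f \<in> PiE {1..r} (\<lambda>_. {1..n}). inj_on f {1..r}}"
proof (rule bij_betwI')
  fix v w assume v: "v \<in> coset_reps n r" and w: "w \<in> coset_reps n r"
  have "v = w" if eq: "restrict v {1..r} = restrict w {1..r}"
  proof
    have 1: "v i = w i" if "i \<in> {1..r}" for i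
      using fun_cong[OF eq, of i] that by simp
    then have "v ` {1..r} = w ` {1..r}" by (metis image_cong)
    then have "v ` {r+1..n} = w ` {r+1..n}" using coset_reps_image[OF v assms] coset_reps_image[OF w assms] by simp
    then have set: "set (map v [r+1..<n+1]) = set (map w [r+1..<n+1])"
      by (simp only: set_map set_upt Suc_eq_plus1[symmetric] atLeastLessThanSuc_atLeastAtMost)
    have srt: "sorted_wrt (<) (map u [r+1..<n+1])" if "u \<in> coset_reps n r" for u
      using that unfolding sorted_wrt_map by (auto simp: sorted_wrt_iff_nth_less coset_reps_def simp del: upt_Suc)
    have "map v [r+1..<n+1] = map w [r+1..<n+1]"
      by (rule strict_sorted_equal[OF srt[OF w] srt[OF v] set])
    then have 2: "v i = w i" if "i \<in> {r+1..n}" for i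
      using that by (simp del: upt_Suc)
    fix i
    consider "i \<in> {1..r}" | "i \<in> {r+1..n}" | "i \<notin> {1..n}" by fastforce
    then show "v i = w i"
    proof cases
      case 3
      then show ?thesis
        using v w permutes_not_in[of v "{1..n}" i] permutes_not_in[of w "{1..n}" i]
        by (simp add: coset_reps_def)
    qed (fact 1, fact 2)
  qed
  then show "(restrict v {1..r} = restrict w {1..r}) = (v = w)" by auto
next
  fix w assume "w \<in> coset_reps n r"
  then have w: "w permutes {1..n}" by (simp add: coset_reps_def)
  have "w i \<in> {1..n}" if "i \<in> {1..r}" for i using permutes_in_image[OF w, of i] that assms by auto
  then show "restrict w {1..r} \<in> {f \<in> PiE {1..r} (\<lambda>_. {1..n}). inj_on f {1..r}}"
    using permutes_inj_on[OF w, of "{1..r}"] by auto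
next
  fix f assume "f \<in> {f \<in> PiE {1..r} (\<lambda>_. {1..n}). inj_on f {1..r}}"
  then have f: "f \<in> PiE {1..r} (\<lambda>_. {1..n})" "inj_on f {1..r}" by auto
  define C where "C = {1..n} - f ` {1..r}"
  define L where "L = sorted_list_of_set C"
  have sub: "f ` {1..r} \<subseteq> {1..n}" using f(1) by auto
  have C: "finite C" "card C = n - r"
    unfolding C_def using sub f(2) by (simp_all add: card_Diff_subset card_image)
  have L: "length L = n - r" "distinct L" "set L = C" "sorted_wrt (<) L"
    unfolding L_def using C by (simp_all add: strict_sorted_list_of_set)
  \<comment> \<open>Position r + 1 receives the head of the sorted list L, whence the offset r +
    1.\<close>
  define w where "w k = (if k \<in> {1..r} then f k else if k \<in> {r+1..n} then L ! (k - (r+1)) else k)" for k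
  have 1: "bij_betw w {1..r} (f ` {1..r})"
    by (rule bij_betw_cong[THEN iffD1, OF _ inj_on_imp_bij_betw[OF f(2)]]) (simp add: w_def)
  have "bij_betw (\<lambda>k. k - (r+1)) {r+1..n} {..<length L}"
    by (rule bij_betw_byWitness[where f'="\<lambda>k. k + (r+1)"]) (use L(1) in auto)
  from bij_betw_trans[OF this bij_betw_nth[OF L(2) refl L(3)[symmetric]]]
  have 2: "bij_betw w {r+1..n} C"
    by (rule bij_betw_cong[THEN iffD1, rotated]) (auto simp: w_def)
  have "bij_betw w ({1..r} \<union> {r+1..n}) (f ` {1..r} \<union> C)"
    by (rule bij_betw_combine[OF 1 2]) (auto simp: C_def)
  moreover have "{1..r} \<union> {r+1..n} = {1..n}" "f ` {1..r} \<union> C = {1..n}"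
    using assms sub by (auto simp: C_def)
  ultimately have "bij_betw w {1..n} {1..n}" by simp
  then have "w permutes {1..n}"
    by (rule bij_imp_permutes) (use assms in \<open>auto simp: w_def\<close>)
  moreover have "w i < w j" if "r < i" "i < j" "j \<le> n" for i j
  proof -
    have "L ! (i - (r+1)) < L ! (j - (r+1))"
      by (rule sorted_wrt_nth_less[OF L(4)]) (use that L(1) in auto)
    then show ?thesis using that by (simp add: w_def)
  qed
  ultimately have "w \<in> coset_reps n r" by (simp add: coset_reps_def)
  moreover have "f = restrict w {1..r}"
    using f(1) by (auto simp: fun_eq_iff w_def PiE_def extensional_def)
  ultimately show "\<exists>w\<in>coset_reps n r. f = restrict w {1..r}" by blast
qed

theorem mainTheorem18:
  fixes n m :: nat and nu :: "nat \<Rightarrow> nat"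
  assumes "2 * m \<le> n"
    and "\<forall>i. 1 \<le> i \<longrightarrow> i < 2 * m \<longrightarrow> nu (i + 1) < nu i"
    and "\<forall>i. 1 \<le> i \<longrightarrow> i \<le> 2 * m \<longrightarrow> 0 < nu i"
  shows "GQ n (2 * m) nu =
    emb (pfaffian m (\<lambda>i j.
      tsum (\<lambda>(k, l). of_int (zbinom (int i + 1 - 2 * int m) k * zbinom (int j - 2 * int m) l)
                      * beta ^ (k + l) * GQpq n (nu i) (nu j) (nu i + k) (nu j + l)) UNIV))"
    (is "_ = emb (pfaffian m ?M)")
proof -
  let ?r = "2 * m"
  let ?E = "PiE {1..?r} (\<lambda>_. {1..n})"
  let ?T = "\<lambda>f. (\<Prod>t\<in>{1..?r}. Pcoef n m nu t (f t)) * (\<Prod>i\<in>{1..?r}. \<Prod>j\<in>{i+1..?r}. Kcoef (f i) (f j))"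
  have "emb (pfaffian m ?M) = pfaffian m (\<lambda>i j. emb (?M i j))" by (rule emb_pfaffian)
  also have "\<dots> = pfaffian m (\<lambda>i j. \<Sum>a\<in>{1..n}. \<Sum>b\<in>{1..n}. Pcoef n m nu i a * (Pcoef n m nu j b * Kcoef a b))"
    \<comment> \<open>An entry has 1 <= i < j <= 2m <= n, which yields the n >= 1 of
      \<open>matrix_entry\<close>; for m = 0 there are no entries.\<close>
    by (rule pfaffian_cong, rule matrix_entry) (use assms in auto)
  also have "\<dots> = (\<Sum>f\<in>?E. ?T f)"
    unfolding pfaffian_multilinear pfaffian_Kcoef ..
  also have "\<dots> = (\<Sum>f\<in>{f \<in> ?E. inj_on f {1..?r}}. ?T f)"
  proof (rule sum.mono_neutral_right)
    show "\<forall>f\<in>?E - {f \<in> ?E. inj_on f {1..?r}}. ?T f = 0"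
    proof
      fix f assume "f \<in> ?E - {f \<in> ?E. inj_on f {1..?r}}"
      then have "\<not> inj_on f {1..?r}" by blast
      from prod_Kcoef_not_inj[OF this] show "?T f = 0" by (simp only: mult_zero_right)
    qed
  qed (auto intro!: finite_PiE)
  also have "\<dots> = (\<Sum>f\<in>{f \<in> ?E. inj_on f {1..?r}}. orbit_term n ?r nu f)"
    by (rule sum.cong[OF refl], rule prod_Pcoef_Kcoef) auto
  also have "\<dots> = (\<Sum>w\<in>coset_reps n ?r. orbit_term n ?r nu (restrict w {1..?r}))"
    by (rule sum.reindex_bij_betw[OF bij_betw_coset_reps[OF assms(1)], symmetric])
  also have "\<dots> = GQ n ?r nu" by (rule GQ_orbit[OF assms(1), symmetric])
  finally show ?thesis ..
qed

end
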